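(* Over $\mathsf{RCA}_0^*$, the following are equivalent. (1) $\mathsf{I}\Sigma^0_2$, the induction scheme for $\Sigma^0_2$ formulas. (2) $\mathsf{ECT}$: for every $k\in\mathbb N$ and every $f:\mathbb N\to k$ there is a $b\in\mathbb N$ such that for all $x\ge b$ there is a $y>x$ such that $f(x)=f(y)$.
   Context: $\mathsf{RCA}_0$ is the subsystem of second order arithmetic with basic arithmetic axioms, $\Sigma^0_1$ induction, and recursive ($\Delta^0_1$) comprehension. $\mathsf{RCA}_0^*$ has the axioms of $\mathsf{RCA}_0$ less the $\Sigma^0_1$ induction scheme, with the addition of a $\Sigma^0_0$ induction scheme and function symbols and axioms for integer exponentiation. The number $k$ is identified with $\{0,\dots,k-1\}$; functions are coded by sets; number quantifiers range over all numbers of the model. *)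

theory Defs
  imports Main
begin

text \<open>
  Syntax and semantics of the two-sorted language of second order arithmetic with exponentiation.
  Variables are de Bruijn indices; number variables and set variables are indexed separately, so
  a number quantifier leaves set indices alone and vice versa.
\<close>

datatype trm =
    Var nat
  | Zero
  | One
  | Add trm trm
  | Mul trm trm
  | Exp trm trm  \<comment> \<open>base first\<close>

datatype fm =
    Eq trm trm
  | Less trm trm
  | Mem trm nat
  | Neg fm
  | Conj fm fm
  | Disj fm fm
  | Imp fm fm
  | Iff fm fm
  | All fm
  | Ex fm
  | AllS fm
  | ExS fm

text \<open>
  The first-order part of a structure is the whole type \<open>'a\<close>; the set quantifiers range over
  \<open>Sets M\<close>, an arbitrary family of subsets of it (Henkin semantics).
\<close>

record 'a l2_structure =
  zero :: 'a
  one :: 'a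
  add :: "'a \<Rightarrow> 'a \<Rightarrow> 'a"
  mul :: "'a \<Rightarrow> 'a \<Rightarrow> 'a"
  exp :: "'a \<Rightarrow> 'a \<Rightarrow> 'a"
  less :: "'a \<Rightarrow> 'a \<Rightarrow> bool"
  Sets :: "'a set set"

primrec val :: "('a, 'b) l2_structure_scheme \<Rightarrow> (nat \<Rightarrow> 'a) \<Rightarrow> trm \<Rightarrow> 'a" where
  "val M e (Var i) = e i"
| "val M e Zero = zero M"
| "val M e One = one M"
| "val M e (Add s t) = add M (val M e s) (val M e t)"
| "val M e (Mul s t) = mul M (val M e s) (val M e t)"
| "val M e (Exp s t) = exp M (val M e s) (val M e t)"

primrec sat ::
  "('a, 'b) l2_structure_scheme \<Rightarrow> (nat \<Rightarrow> 'a) \<Rightarrow> (nat \<Rightarrow> 'a set) \<Rightarrow> fm \<Rightarrow> bool" where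
  "sat M e E (Eq s t) \<longleftrightarrow> val M e s = val M e t"
| "sat M e E (Less s t) \<longleftrightarrow> less M (val M e s) (val M e t)"
| "sat M e E (Mem t X) \<longleftrightarrow> val M e t \<in> E X"
| "sat M e E (Neg p) \<longleftrightarrow> \<not> sat M e E p"
| "sat M e E (Conj p q) \<longleftrightarrow> sat M e E p \<and> sat M e E q"
| "sat M e E (Disj p q) \<longleftrightarrow> sat M e E p \<or> sat M e E q"
| "sat M e E (Imp p q) \<longleftrightarrow> (sat M e E p \<longrightarrow> sat M e E q)"
| "sat M e E (Iff p q) \<longleftrightarrow> (sat M e E p \<longleftrightarrow> sat M e E q)"
| "sat M e E (All p) \<longleftrightarrow> (\<forall>a. sat M (case_nat a e) E p)"
| "sat M e E (Ex p) \<longleftrightarrow> (\<exists>a. sat M (case_nat a e) E p)"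
| "sat M e E (AllS p) \<longleftrightarrow> (\<forall>A\<in>Sets M. sat M e (case_nat A E) p)"
| "sat M e E (ExS p) \<longleftrightarrow> (\<exists>A\<in>Sets M. sat M e (case_nat A E) p)"

text \<open>
  Quantifying over all assignments amounts to taking universal closures, provided that \<open>Sets M\<close>
  is nonempty; otherwise there are no assignments.
\<close>

definition models :: "('a, 'b) l2_structure_scheme \<Rightarrow> fm set \<Rightarrow> bool" where
  "models M T \<longleftrightarrow> (\<forall>p\<in>T. \<forall>e E. range E \<subseteq> Sets M \<longrightarrow> sat M e E p)"

text \<open>
  Simultaneous capture-avoiding substitution of terms for number variables and renaming of set
  variables.
\<close>

primrec subst_trm :: "(nat \<Rightarrow> trm) \<Rightarrow> trm \<Rightarrow> trm" where
  "subst_trm \<sigma> (Var i) = \<sigma> i"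
| "subst_trm \<sigma> Zero = Zero"
| "subst_trm \<sigma> One = One"
| "subst_trm \<sigma> (Add s t) = Add (subst_trm \<sigma> s) (subst_trm \<sigma> t)"
| "subst_trm \<sigma> (Mul s t) = Mul (subst_trm \<sigma> s) (subst_trm \<sigma> t)"
| "subst_trm \<sigma> (Exp s t) = Exp (subst_trm \<sigma> s) (subst_trm \<sigma> t)"

abbreviation lift :: "trm \<Rightarrow> trm" where
  "lift \<equiv> subst_trm (\<lambda>i. Var (Suc i))"

primrec subst :: "(nat \<Rightarrow> trm) \<Rightarrow> (nat \<Rightarrow> nat) \<Rightarrow> fm \<Rightarrow> fm" where
  "subst \<sigma> \<rho> (Eq s t) = Eq (subst_trm \<sigma> s) (subst_trm \<sigma> t)"
| "subst \<sigma> \<rho> (Less s t) = Less (subst_trm \<sigma> s) (subst_trm \<sigma> t)"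
| "subst \<sigma> \<rho> (Mem t X) = Mem (subst_trm \<sigma> t) (\<rho> X)"
| "subst \<sigma> \<rho> (Neg p) = Neg (subst \<sigma> \<rho> p)"
| "subst \<sigma> \<rho> (Conj p q) = Conj (subst \<sigma> \<rho> p) (subst \<sigma> \<rho> q)"
| "subst \<sigma> \<rho> (Disj p q) = Disj (subst \<sigma> \<rho> p) (subst \<sigma> \<rho> q)"
| "subst \<sigma> \<rho> (Imp p q) = Imp (subst \<sigma> \<rho> p) (subst \<sigma> \<rho> q)"
| "subst \<sigma> \<rho> (Iff p q) = Iff (subst \<sigma> \<rho> p) (subst \<sigma> \<rho> q)"
| "subst \<sigma> \<rho> (All p) = All (subst (case_nat (Var 0) (\<lambda>i. lift (\<sigma> i))) \<rho> p)"
| "subst \<sigma> \<rho> (Ex p) = Ex (subst (case_nat (Var 0) (\<lambda>i. lift (\<sigma> i))) \<rho> p)"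
| "subst \<sigma> \<rho> (AllS p) = AllS (subst \<sigma> (case_nat 0 (\<lambda>X. Suc (\<rho> X))) p)"
| "subst \<sigma> \<rho> (ExS p) = ExS (subst \<sigma> (case_nat 0 (\<lambda>X. Suc (\<rho> X))) p)"

lemma val_subst_trm: "val M e (subst_trm \<sigma> t) = val M (\<lambda>i. val M e (\<sigma> i)) t"
  by (induction t) auto

lemma sat_subst: "sat M e E (subst \<sigma> \<rho> p) \<longleftrightarrow> sat M (\<lambda>i. val M e (\<sigma> i)) (\<lambda>X. E (\<rho> X)) p"
proof (induction p arbitrary: e E \<sigma> \<rho>)
  case (All p)
  have "(\<lambda>i. val M (case_nat a e) (case_nat (Var 0) (\<lambda>i. lift (\<sigma> i)) i)) =
      case_nat a (\<lambda>i. val M e (\<sigma> i))" for a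
    by (auto simp: fun_eq_iff val_subst_trm split: nat.split)
  then show ?case by (simp add: All)
next
  case (Ex p)
  have "(\<lambda>i. val M (case_nat a e) (case_nat (Var 0) (\<lambda>i. lift (\<sigma> i)) i)) =
      case_nat a (\<lambda>i. val M e (\<sigma> i))" for a
    by (auto simp: fun_eq_iff val_subst_trm split: nat.split)
  then show ?case by (simp add: Ex)
next
  case (AllS p)
  have "(\<lambda>X. case_nat A E (case_nat 0 (\<lambda>X. Suc (\<rho> X)) X)) = case_nat A (\<lambda>X. E (\<rho> X))" for A
    by (auto simp: fun_eq_iff split: nat.split)
  then show ?case by (simp add: AllS)
next
  case (ExS p)
  have "(\<lambda>X. case_nat A E (case_nat 0 (\<lambda>X. Suc (\<rho> X)) X)) = case_nat A (\<lambda>X. E (\<rho> X))" for A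
    by (auto simp: fun_eq_iff split: nat.split)
  then show ?case by (simp add: ExS)
qed (simp_all add: val_subst_trm)

text \<open>
  Bounded formulas have no set quantifiers, but set variables may occur as parameters. Lifting
  the bound \<open>t\<close> expresses that the quantified variable does not occur in it.
\<close>

inductive_set bounded_fms :: "fm set" where
  "Eq s t \<in> bounded_fms"
| "Less s t \<in> bounded_fms"
| "Mem t X \<in> bounded_fms"
| "p \<in> bounded_fms \<Longrightarrow> Neg p \<in> bounded_fms"
| "p \<in> bounded_fms \<Longrightarrow> q \<in> bounded_fms \<Longrightarrow> Conj p q \<in> bounded_fms"
| "p \<in> bounded_fms \<Longrightarrow> q \<in> bounded_fms \<Longrightarrow> Disj p q \<in> bounded_fms"
| "p \<in> bounded_fms \<Longrightarrow> q \<in> bounded_fms \<Longrightarrow> Imp p q \<in> bounded_fms"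
| "p \<in> bounded_fms \<Longrightarrow> q \<in> bounded_fms \<Longrightarrow> Iff p q \<in> bounded_fms"
| "p \<in> bounded_fms \<Longrightarrow> All (Imp (Less (Var 0) (lift t)) p) \<in> bounded_fms"
| "p \<in> bounded_fms \<Longrightarrow> Ex (Conj (Less (Var 0) (lift t)) p) \<in> bounded_fms"

fun Sigma0 :: "nat \<Rightarrow> fm set" and Pi0 :: "nat \<Rightarrow> fm set" where
  "Sigma0 0 = bounded_fms"
| "Sigma0 (Suc n) = Ex ` Pi0 n"
| "Pi0 0 = bounded_fms"
| "Pi0 (Suc n) = All ` Sigma0 n"

definition basic_axioms :: "fm set" where
  "basic_axioms = {
    Neg (Eq (Add (Var 0) One) Zero),
    Imp (Eq (Add (Var 0) One) (Add (Var 1) One)) (Eq (Var 0) (Var 1)),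
    Eq (Add (Var 0) Zero) (Var 0),
    Eq (Add (Var 0) (Add (Var 1) One)) (Add (Add (Var 0) (Var 1)) One),
    Eq (Mul (Var 0) Zero) Zero,
    Eq (Mul (Var 0) (Add (Var 1) One)) (Add (Mul (Var 0) (Var 1)) (Var 0)),
    Neg (Less (Var 0) Zero),
    Iff (Less (Var 0) (Add (Var 1) One)) (Disj (Less (Var 0) (Var 1)) (Eq (Var 0) (Var 1)))}"

definition exp_axioms :: "fm set" where
  "exp_axioms = {
    Eq (Exp (Var 0) Zero) One,
    Eq (Exp (Var 0) (Add (Var 1) One)) (Mul (Exp (Var 0) (Var 1)) (Var 0))}"

text \<open>The induction variable is number variable 0; all other variables are parameters.\<close>

definition induction_axiom :: "fm \<Rightarrow> fm" where
  "induction_axiom p =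
    Imp
      (Conj
        (subst (case_nat Zero Var) id p)
        (All (Imp p (subst (Var(0 := Add (Var 0) One)) id p))))
      (All p)"

definition induction_scheme :: "fm set \<Rightarrow> fm set" where
  "induction_scheme \<Gamma> = induction_axiom ` \<Gamma>"

text \<open>
  Under the set quantifier, the set parameters of \<open>p\<close> are shifted by one; in particular the new
  set is not free in \<open>p\<close>.
\<close>

definition comprehension_axiom :: "fm \<Rightarrow> fm \<Rightarrow> fm" where
  "comprehension_axiom p q =
    Imp (All (Iff p q)) (ExS (All (Iff (Mem (Var 0) 0) (subst Var Suc p))))"

definition Delta01_comprehension :: "fm set" where
  "Delta01_comprehension = {comprehension_axiom p q | p q. p \<in> Sigma0 1 \<and> q \<in> Pi0 1}"

definition RCA0_star :: "fm set" where
  "RCA0_star =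
    basic_axioms \<union> exp_axioms \<union> induction_scheme (Sigma0 0) \<union> Delta01_comprehension"

definition ISigma02 :: "fm set" where
  "ISigma02 = induction_scheme (Sigma0 2)"

lemma sat_induction_axiom:
  "sat M e E (induction_axiom p) \<longleftrightarrow>
    (sat M (case_nat (zero M) e) E p \<and>
      (\<forall>a. sat M (case_nat a e) E p \<longrightarrow> sat M (case_nat (add M a (one M)) e) E p) \<longrightarrow>
    (\<forall>a. sat M (case_nat a e) E p))"
proof -
  have "(\<lambda>i. val M e (case_nat Zero Var i)) = case_nat (zero M) e"
    by (auto simp: fun_eq_iff split: nat.split)
  moreover have "(\<lambda>i. val M (case_nat a e) ((Var(0 := Add (Var 0) One)) i)) =
      case_nat (add M a (one M)) e" for a
    by (auto simp: fun_eq_iff split: nat.split)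
  ultimately show ?thesis
    by (simp add: induction_axiom_def sat_subst del: fun_upd_apply)
qed

lemma sat_comprehension_axiom:
  "sat M e E (comprehension_axiom p q) \<longleftrightarrow>
    ((\<forall>a. sat M (case_nat a e) E p \<longleftrightarrow> sat M (case_nat a e) E q) \<longrightarrow>
    {a. sat M (case_nat a e) E p} \<in> Sets M)"
proof -
  have "(\<exists>A\<in>Sets M. \<forall>a. a \<in> A \<longleftrightarrow> P a) \<longleftrightarrow> {a. P a} \<in> Sets M" for P
    by (metis Collect_mem_eq Collect_cong mem_Collect_eq)
  then show ?thesis
    by (simp add: comprehension_axiom_def sat_subst)
qed

text \<open>
  Functions are sets of ordered pairs, with the pairing \<open>(i, j) = (i + j)\<^sup>2 + i\<close>. The formula
  \<open>maps_into t X\<close> says that \<open>X\<close> is a function from all numbers to the numbers below \<open>t\<close>: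
  a subset of the product that relates each number to exactly one value.
\<close>

definition pair :: "trm \<Rightarrow> trm \<Rightarrow> trm" where
  "pair s t = Add (Mul (Add s t) (Add s t)) s"

definition maps_into :: "trm \<Rightarrow> nat \<Rightarrow> fm" where
  "maps_into t X =
    Conj
      (All (Imp (Mem (Var 0) X)
        (Ex (Ex (Conj
          (Eq (Var 2) (pair (Var 1) (Var 0)))
          (Less (Var 0) (lift (lift (lift t)))))))))
      (All (Ex (Conj
        (Mem (pair (Var 1) (Var 0)) X)
        (All (Imp (Mem (pair (Var 2) (Var 0)) X) (Eq (Var 0) (Var 1)))))))"

text \<open>The quantified variables are, in order, \<open>k\<close>, \<open>f\<close>, \<open>b\<close>, \<open>x\<close>, \<open>y\<close> and the common value of \<open>f\<close>.\<close>

definition ECT :: fm where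
  "ECT =
    All (AllS (Imp (maps_into (Var 0) 0)
      (Ex (All (Imp (Disj (Less (Var 1) (Var 0)) (Eq (Var 1) (Var 0)))
        (Ex (Conj (Less (Var 1) (Var 0))
          (Ex (Conj
            (Mem (pair (Var 2) (Var 0)) 0)
            (Mem (pair (Var 1) (Var 0)) 0))))))))))"

lemma sat_ECT:
  fixes M :: "('a, 'b) l2_structure_scheme"
  defines "P \<equiv> \<lambda>i j. add M (mul M (add M i j) (add M i j)) i"
  shows "sat M e E ECT \<longleftrightarrow>
    (\<forall>k. \<forall>f\<in>Sets M.
      (\<forall>n\<in>f. \<exists>i j. n = P i j \<and> less M j k) \<and> (\<forall>i. \<exists>!j. P i j \<in> f) \<longrightarrow>
      (\<exists>b. \<forall>x. less M b x \<or> b = x \<longrightarrow>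
        (\<exists>y. less M x y \<and> (\<exists>v. P x v \<in> f \<and> P y v \<in> f))))"
  by (simp add: ECT_def maps_into_def pair_def P_def numeral_eq_Suc Ball_def Ex1_def)

end

theory Submission
  imports Defs
begin

text \<open>
  Write \<open>\<psi>(n) = \<exists>b. \<forall>x. \<theta>(n, b, x)\<close> with \<open>\<theta>\<close> bounded for a \<open>\<Sigma>\<^sup>0\<^sub>2\<close> formula, and call a colour of
  \<open>f\<close> transient if it has a last occurrence.

  Induction implies ECT: one wants a single number past which no transient colour occurs. Code
  sets of colours below \<open>k\<close> by numbers below \<open>2\<^sup>k\<close>, in binary, and consider the codes \<open>s\<close> for which
  no member of \<open>s\<close> occurs from some \<open>w\<close> on. This property of \<open>s\<close> is \<open>\<Sigma>\<^sup>0\<^sub>2\<close>. If \<open>w\<close> did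
  not witness ECT, then some \<open>x \<ge> w\<close> is the last occurrence of its colour \<open>v\<close>; as \<open>v\<close> occurs
  from \<open>w\<close> on it is not in \<open>s\<close>, and \<open>s + 2\<^sup>v\<close> is a larger code with the property (\<open>insert_bit\<close>). So if ECT
  failed, induction on \<open>n\<close> would produce such codes \<open>s \<ge> n\<close> below \<open>2\<^sup>k\<close> for every \<open>n\<close>, also for
  \<open>n = 2\<^sup>k\<close>.

  ECT implies induction: the base theory has induction for bounded formulas only, so even
  \<open>\<Sigma>\<^sup>0\<^sub>1\<close> induction has to come out of ECT. All that is needed of it is contained in one fact
  (\<open>ECT_eventually_constant\<close>): a bounded monotone function with bounded definable graph is eventually
  constant, because a monotone function that returns to a value has not left it in between.

  For each \<open>n\<close> let the guess at stage \<open>t\<close> be the least candidate \<open>b\<close> for \<open>\<psi>(n)\<close> that is not refuted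
  by any \<open>x \<le> t\<close>, or \<open>t + 1\<close> if all \<open>b \<le> t\<close> are refuted. Guesses never decrease. If \<open>\<psi>(n)\<close> holds,
  they are bounded by a witness, hence stabilize (\<open>stable_if_witness\<close>); conversely, if they stabilize
  then the final guess is a witness (\<open>witness_if_stable\<close>). Now suppose that \<open>\<psi>(a)\<close> fails. Colour the
  number \<open>q (a + 1) + n\<close>, where \<open>n \<le> a\<close>, by \<open>n\<close> if the guess for \<open>n\<close> changes at stage \<open>q\<close>, and by the
  dummy colour \<open>a + 1\<close> otherwise. A colour \<open>n \<le> a\<close> is transient or absent iff \<open>\<psi>(n)\<close>; so with \<open>B\<close>
  as given by ECT, \<open>\<psi>(n)\<close> holds iff \<open>n\<close> does not occur from \<open>B\<close> on. This turns \<open>\<psi>\<close> into a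
  \<open>\<Pi>\<^sup>0\<^sub>1\<close> property below \<open>a\<close>. The least of \<open>a\<close> and the colours that occur in \<open>[B, t]\<close> does not
  increase with \<open>t\<close>, so it is eventually constant, and its final value is the least \<open>n\<close> without
  \<open>\<psi>(n)\<close>. Hence \<open>\<psi>\<close> is not inductive.

  Everything is done semantically, inside one model. Predicates on the model that are definable by
  a bounded formula with parameters form a class \<open>delta0\<close> with syntax-directed closure rules, and
  the axioms of the model become statements about that class. Arithmetic is developed until the
  model is seen to be a linearly ordered semiring, which gives access to the algebraic lemmas of
  the corresponding type class.
\<close>

section \<open>Bounded definability with parameters\<close>

lemma subst_trm_lift:
  "subst_trm (case_nat (Var 0) (\<lambda>i. lift (\<sigma> i))) (lift t) = lift (subst_trm \<sigma> t)"
  by (induction t) auto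

lemma subst_bounded_fms: "p \<in> bounded_fms \<Longrightarrow> subst \<sigma> \<rho> p \<in> bounded_fms"
proof (induction arbitrary: \<sigma> \<rho> rule: bounded_fms.induct)
  case (9 p t)
  then show ?case by (simp add: subst_trm_lift bounded_fms.intros)
next
  case (10 p t)
  then show ?case by (simp add: subst_trm_lift bounded_fms.intros)
qed (auto intro: bounded_fms.intros)

text \<open>
  An assignment is split into an infinite supply of arguments, on the even indices, and an infinite
  supply of parameters, on the odd ones. Two formulas with different parameters can then be brought
  to a common list of parameters by interleaving their parameter lists, without looking at the
  variables that occur in them.
\<close>

definition interleave :: "(nat \<Rightarrow> 'b) \<Rightarrow> (nat \<Rightarrow> 'b) \<Rightarrow> nat \<Rightarrow> 'b" where
  "interleave f g i = (if even i then f (i div 2) else g (i div 2))"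

lemma interleave_even [simp]: "interleave f g (2 * i) = f i"
  and interleave_odd [simp]: "interleave f g (Suc (2 * i)) = g i"
  by (simp_all add: interleave_def)

lemma range_interleave: "range f \<subseteq> S \<Longrightarrow> range g \<subseteq> S \<Longrightarrow> range (interleave f g) \<subseteq> S"
  by (auto simp: interleave_def)

locale nonempty_model =
  fixes M :: "'a l2_structure"
  assumes Sets_nonempty: "Sets M \<noteq> {}"
begin

definition rep_trm :: "(nat \<Rightarrow> 'a) \<Rightarrow> ((nat \<Rightarrow> 'a) \<Rightarrow> 'a) \<Rightarrow> bool" where
  "rep_trm c T \<longleftrightarrow> (\<exists>t. \<forall>e. val M (interleave e c) t = T e)"

definition rep_fm :: "(nat \<Rightarrow> 'a) \<Rightarrow> (nat \<Rightarrow> 'a set) \<Rightarrow> ((nat \<Rightarrow> 'a) \<Rightarrow> bool) \<Rightarrow> bool" where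
  "rep_fm c E P \<longleftrightarrow> (\<exists>p\<in>bounded_fms. \<forall>e. sat M (interleave e c) E p \<longleftrightarrow> P e)"

definition definable_trm :: "((nat \<Rightarrow> 'a) \<Rightarrow> 'a) \<Rightarrow> bool" where
  "definable_trm T \<longleftrightarrow> (\<exists>c. rep_trm c T)"

text \<open>
  A predicate is definable if it is the satisfaction of a bounded formula with number parameters \<open>c\<close>
  and set parameters \<open>E\<close> from the model. As the parameters are existentially quantified, arbitrary
  elements and sets of the model may occur in a predicate that is shown to be definable.
\<close>

definition delta0 :: "((nat \<Rightarrow> 'a) \<Rightarrow> bool) \<Rightarrow> bool" where
  "delta0 P \<longleftrightarrow> (\<exists>c E. range E \<subseteq> Sets M \<and> rep_fm c E P)"

lemma rep_trm_reindex:
  assumes "rep_trm c T" and "\<And>i. c i = c' (r i)"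
  shows "rep_trm c' T"
proof -
  obtain t where t: "\<And>e. val M (interleave e c) t = T e"
    using assms(1) by (auto simp: rep_trm_def)
  let ?s = "interleave (\<lambda>i. Var (2 * i)) (\<lambda>i. Var (Suc (2 * r i)))"
  have "(\<lambda>i. val M (interleave e c') (?s i)) = interleave e c" for e
    by (auto simp: fun_eq_iff interleave_def assms(2))
  then have "val M (interleave e c') (subst_trm ?s t) = T e" for e
    by (simp add: val_subst_trm t)
  then show ?thesis by (auto simp: rep_trm_def)
qed

lemma rep_fm_reindex:
  assumes "rep_fm c E P" and "\<And>i. c i = c' (r i)" and "\<And>i. E i = E' (r' i)"
  shows "rep_fm c' E' P"
proof -
  obtain p where p: "p \<in> bounded_fms" "\<And>e. sat M (interleave e c) E p \<longleftrightarrow> P e"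
    using assms(1) by (auto simp: rep_fm_def)
  let ?s = "interleave (\<lambda>i. Var (2 * i)) (\<lambda>i. Var (Suc (2 * r i)))"
  have "(\<lambda>i. val M (interleave e c') (?s i)) = interleave e c" for e
    by (auto simp: fun_eq_iff interleave_def assms(2))
  moreover have "(\<lambda>X. E' (r' X)) = E" by (rule ext) (rule assms(3)[symmetric])
  ultimately have "sat M (interleave e c') E' (subst ?s r' p) \<longleftrightarrow> P e" for e
    by (simp add: sat_subst p)
  then show ?thesis using p(1) subst_bounded_fms unfolding rep_fm_def by blast
qed

lemma common_rep_trm:
  assumes "definable_trm T" "definable_trm S"
  obtains c where "rep_trm c T" "rep_trm c S"
proof -
  obtain c d where cd: "rep_trm c T" "rep_trm d S" using assms by (auto simp: definable_trm_def)
  have "rep_trm (interleave c d) T" by (rule rep_trm_reindex[OF cd(1), where r = "\<lambda>i. 2 * i"]) simp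
  moreover have "rep_trm (interleave c d) S"
    by (rule rep_trm_reindex[OF cd(2), where r = "\<lambda>i. Suc (2 * i)"]) simp
  ultimately show ?thesis by (rule that)
qed

lemma common_rep_trm_fm:
  assumes "definable_trm T" "delta0 P"
  obtains c E where "range E \<subseteq> Sets M" "rep_trm c T" "rep_fm c E P"
proof -
  obtain c d E where cd: "rep_trm c T" "rep_fm d E P" "range E \<subseteq> Sets M"
    using assms by (auto simp: definable_trm_def delta0_def)
  have "rep_trm (interleave c d) T" by (rule rep_trm_reindex[OF cd(1), where r = "\<lambda>i. 2 * i"]) simp
  moreover have "rep_fm (interleave c d) E P"
    by (rule rep_fm_reindex[OF cd(2), where r = "\<lambda>i. Suc (2 * i)" and r' = id]) simp_all
  ultimately show ?thesis using cd(3) that by blast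
qed

lemma common_rep_fm:
  assumes "delta0 P" "delta0 Q"
  obtains c E where "range E \<subseteq> Sets M" "rep_fm c E P" "rep_fm c E Q"
proof -
  obtain c d C D where cd: "rep_fm c C P" "rep_fm d D Q" "range C \<subseteq> Sets M" "range D \<subseteq> Sets M"
    using assms by (auto simp: delta0_def)
  have "rep_fm (interleave c d) (interleave C D) P"
    by (rule rep_fm_reindex[OF cd(1), where r = "\<lambda>i. 2 * i" and r' = "\<lambda>i. 2 * i"]) simp_all
  moreover have "rep_fm (interleave c d) (interleave C D) Q"
    by (rule rep_fm_reindex[OF cd(2), where r = "\<lambda>i. Suc (2 * i)" and r' = "\<lambda>i. Suc (2 * i)"])
      simp_all
  moreover have "range (interleave C D) \<subseteq> Sets M" using cd(3,4) by (rule range_interleave)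
  ultimately show ?thesis using that by blast
qed

lemma definable_var: "definable_trm (\<lambda>e. e i)"
proof -
  have "rep_trm c (\<lambda>e. e i)" for c
    unfolding rep_trm_def by (rule exI[of _ "Var (2 * i)"]) simp
  then show ?thesis unfolding definable_trm_def by blast
qed

text \<open>
  Backward uses of the quantifier rules shift the arguments of a term; this is the rule for a term
  that is itself given only by a definability assumption.
\<close>

lemma definable_reindex:
  assumes "definable_trm T"
  shows "definable_trm (\<lambda>e. T (\<lambda>i. e (r i)))"
proof -
  obtain c t where t: "\<And>e. val M (interleave e c) t = T e"
    using assms unfolding definable_trm_def rep_trm_def by blast
  let ?s = "interleave (\<lambda>i. Var (2 * r i)) (\<lambda>i. Var (Suc (2 * i)))"
  have "(\<lambda>i. val M (interleave e c) (?s i)) = interleave (\<lambda>i. e (r i)) c" for e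
    by (auto simp: fun_eq_iff interleave_def)
  then have "val M (interleave e c) (subst_trm ?s t) = T (\<lambda>i. e (r i))" for e
    by (simp add: val_subst_trm t)
  then show ?thesis unfolding definable_trm_def rep_trm_def by blast
qed

lemma definable_const: "definable_trm (\<lambda>e. a)"
proof -
  have "rep_trm (\<lambda>_. a) (\<lambda>e. a)"
    unfolding rep_trm_def by (rule exI[of _ "Var (Suc 0)"]) (simp add: interleave_def)
  then show ?thesis unfolding definable_trm_def by blast
qed

lemma definable_add:
  assumes "definable_trm T" "definable_trm S"
  shows "definable_trm (\<lambda>e. add M (T e) (S e))"
proof -
  obtain c where "rep_trm c T" "rep_trm c S" using assms by (rule common_rep_trm)
  then have "rep_trm c (\<lambda>e. add M (T e) (S e))"
    unfolding rep_trm_def by (metis val.simps(4))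
  then show ?thesis unfolding definable_trm_def by blast
qed

lemma definable_mul:
  assumes "definable_trm T" "definable_trm S"
  shows "definable_trm (\<lambda>e. mul M (T e) (S e))"
proof -
  obtain c where "rep_trm c T" "rep_trm c S" using assms by (rule common_rep_trm)
  then have "rep_trm c (\<lambda>e. mul M (T e) (S e))"
    unfolding rep_trm_def by (metis val.simps(5))
  then show ?thesis unfolding definable_trm_def by blast
qed

lemma definable_exp:
  assumes "definable_trm T" "definable_trm S"
  shows "definable_trm (\<lambda>e. exp M (T e) (S e))"
proof -
  obtain c where "rep_trm c T" "rep_trm c S" using assms by (rule common_rep_trm)
  then have "rep_trm c (\<lambda>e. exp M (T e) (S e))"
    unfolding rep_trm_def by (metis val.simps(6))
  then show ?thesis unfolding definable_trm_def by blast
qed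

lemma delta0_eq:
  assumes "definable_trm T" "definable_trm S"
  shows "delta0 (\<lambda>e. T e = S e)"
proof -
  obtain c where "rep_trm c T" "rep_trm c S" using assms by (rule common_rep_trm)
  then obtain t s where "\<And>e. val M (interleave e c) t = T e" "\<And>e. val M (interleave e c) s = S e"
    unfolding rep_trm_def by blast
  then have "rep_fm c E (\<lambda>e. T e = S e)" for E
    unfolding rep_fm_def by (intro bexI[of _ "Eq t s"]) (auto intro: bounded_fms.intros)
  moreover obtain A where "A \<in> Sets M" using Sets_nonempty by blast
  then have "range (\<lambda>_::nat. A) \<subseteq> Sets M" by auto
  ultimately show ?thesis unfolding delta0_def by blast
qed

lemma delta0_less:
  assumes "definable_trm T" "definable_trm S"
  shows "delta0 (\<lambda>e. less M (T e) (S e))"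
proof -
  obtain c where "rep_trm c T" "rep_trm c S" using assms by (rule common_rep_trm)
  then obtain t s where "\<And>e. val M (interleave e c) t = T e" "\<And>e. val M (interleave e c) s = S e"
    unfolding rep_trm_def by blast
  then have "rep_fm c E (\<lambda>e. less M (T e) (S e))" for E
    unfolding rep_fm_def by (intro bexI[of _ "Less t s"]) (auto intro: bounded_fms.intros)
  moreover obtain A where "A \<in> Sets M" using Sets_nonempty by blast
  then have "range (\<lambda>_::nat. A) \<subseteq> Sets M" by auto
  ultimately show ?thesis unfolding delta0_def by blast
qed

lemma delta0_mem:
  assumes "definable_trm T" "A \<in> Sets M"
  shows "delta0 (\<lambda>e. T e \<in> A)"
proof -
  obtain c t where t: "\<And>e. val M (interleave e c) t = T e"
    using assms unfolding definable_trm_def rep_trm_def by blast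
  then have "rep_fm c (\<lambda>_. A) (\<lambda>e. T e \<in> A)"
    unfolding rep_fm_def by (intro bexI[of _ "Mem t 0"]) (auto intro: bounded_fms.intros)
  moreover have "range (\<lambda>_::nat. A) \<subseteq> Sets M" using assms by auto
  ultimately show ?thesis unfolding delta0_def by blast
qed

lemma delta0_not:
  assumes "delta0 P"
  shows "delta0 (\<lambda>e. \<not> P e)"
proof -
  obtain c E p where E: "range E \<subseteq> Sets M" and "p \<in> bounded_fms"
    "\<And>e. sat M (interleave e c) E p \<longleftrightarrow> P e"
    using assms unfolding delta0_def rep_fm_def by blast
  then have "rep_fm c E (\<lambda>e. \<not> P e)"
    unfolding rep_fm_def by (intro bexI[of _ "Neg p"]) (auto intro: bounded_fms.intros)
  with E show ?thesis unfolding delta0_def by blast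
qed

lemma delta0_conj:
  assumes "delta0 P" "delta0 Q"
  shows "delta0 (\<lambda>e. P e \<and> Q e)"
proof -
  obtain c E where E: "range E \<subseteq> Sets M" "rep_fm c E P" "rep_fm c E Q"
    using assms by (rule common_rep_fm)
  obtain p q where "p \<in> bounded_fms" "\<And>e. sat M (interleave e c) E p \<longleftrightarrow> P e"
    "q \<in> bounded_fms" "\<And>e. sat M (interleave e c) E q \<longleftrightarrow> Q e"
    using E(2,3) unfolding rep_fm_def by blast
  then have "rep_fm c E (\<lambda>e. P e \<and> Q e)"
    unfolding rep_fm_def by (intro bexI[of _ "Conj p q"]) (auto intro: bounded_fms.intros)
  with E(1) show ?thesis unfolding delta0_def by blast
qed

lemma delta0_disj:
  assumes "delta0 P" "delta0 Q"
  shows "delta0 (\<lambda>e. P e \<or> Q e)"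
  using delta0_not[OF delta0_conj[OF delta0_not[OF assms(1)] delta0_not[OF assms(2)]]] by simp

lemma delta0_imp:
  assumes "delta0 P" "delta0 Q"
  shows "delta0 (\<lambda>e. P e \<longrightarrow> Q e)"
  using delta0_disj[OF delta0_not[OF assms(1)] assms(2)] by (simp only: imp_conv_disj)

text \<open>
  In the hypothesis, argument 0 is the bound variable and the old arguments are shifted by one.
  Applied backwards, the rule therefore performs the translation into de Bruijn indices.
\<close>

lemma delta0_bex:
  assumes "definable_trm T" "delta0 (\<lambda>e. P (e 0) (\<lambda>i. e (Suc i)))"
  shows "delta0 (\<lambda>e. \<exists>a. less M a (T e) \<and> P a e)"
proof -
  obtain c E where E: "range E \<subseteq> Sets M" "rep_trm c T"
    "rep_fm c E (\<lambda>e. P (e 0) (\<lambda>i. e (Suc i)))"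
    using assms by (rule common_rep_trm_fm)
  obtain p where p: "p \<in> bounded_fms"
    "\<And>e. sat M (interleave e c) E p \<longleftrightarrow> P (e 0) (\<lambda>i. e (Suc i))"
    using E(3) unfolding rep_fm_def by blast
  obtain t where t: "\<And>e. val M (interleave e c) t = T e"
    using E(2) unfolding rep_trm_def by blast
  let ?s = "interleave (case_nat (Var 0) (\<lambda>i. Var (Suc (2 * i)))) (\<lambda>i. Var (Suc (Suc (2 * i))))"
  have *: "(\<lambda>i. val M (case_nat a (interleave e c)) (?s i)) = interleave (case_nat a e) c" for a e
    by (auto simp: fun_eq_iff interleave_def split: nat.split)
  let ?q = "Ex (Conj (Less (Var 0) (lift t)) (subst ?s id p))"
  have "sat M (interleave e c) E ?q \<longleftrightarrow> (\<exists>a. less M a (T e) \<and> P a e)" for e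
    by (simp add: sat_subst val_subst_trm t * p)
  moreover have "?q \<in> bounded_fms" by (intro bounded_fms.intros subst_bounded_fms p)
  ultimately have "rep_fm c E (\<lambda>e. \<exists>a. less M a (T e) \<and> P a e)" unfolding rep_fm_def by blast
  with E(1) show ?thesis unfolding delta0_def by blast
qed

lemma delta0_ball:
  assumes "definable_trm T" "delta0 (\<lambda>e. P (e 0) (\<lambda>i. e (Suc i)))"
  shows "delta0 (\<lambda>e. \<forall>a. less M a (T e) \<longrightarrow> P a e)"
  using delta0_not[OF delta0_bex[of T "\<lambda>a e. \<not> P a e", OF assms(1) delta0_not[OF assms(2)]]]
  by simp

lemmas delta0_intros =
  definable_var definable_const definable_add definable_mul definable_exp
  delta0_eq delta0_less delta0_mem delta0_not delta0_conj delta0_disj delta0_imp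
  delta0_bex delta0_ball

text \<open>
  The matrix of a given \<open>\<Sigma>\<^sup>0\<^sub>2\<close> formula may be treated as a definable ternary predicate. All
  of its remaining variables, possibly infinitely many as far as the assignment \<open>d\<close> is concerned,
  are parameters.
\<close>

lemma delta0_sat:
  assumes "q \<in> bounded_fms" "range E \<subseteq> Sets M"
    and "definable_trm T" "definable_trm S" "definable_trm R"
  shows "delta0 (\<lambda>e. sat M (case_nat (T e) (case_nat (S e) (case_nat (R e) d))) E q)"
proof -
  obtain c1 where c1: "rep_trm c1 T" "rep_trm c1 S" using assms(3,4) by (rule common_rep_trm)
  obtain c2 where c2: "rep_trm c2 R" using assms(5) by (auto simp: definable_trm_def)
  let ?c = "interleave (interleave c1 c2) d"
  have "rep_trm ?c T"
    by (rule rep_trm_reindex[OF c1(1), where r = "\<lambda>i. 2 * (2 * i)"])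
      (simp only: interleave_even)
  moreover have "rep_trm ?c S"
    by (rule rep_trm_reindex[OF c1(2), where r = "\<lambda>i. 2 * (2 * i)"])
      (simp only: interleave_even)
  moreover have "rep_trm ?c R"
    by (rule rep_trm_reindex[OF c2, where r = "\<lambda>i. 2 * Suc (2 * i)"])
      (simp only: interleave_even interleave_odd)
  ultimately obtain t s r where "\<And>e. val M (interleave e ?c) t = T e"
    "\<And>e. val M (interleave e ?c) s = S e" "\<And>e. val M (interleave e ?c) r = R e"
    unfolding rep_trm_def by blast
  then have "(\<lambda>i. val M (interleave e ?c)
      (case_nat t (case_nat s (case_nat r (\<lambda>i. Var (Suc (2 * Suc (2 * i)))))) i)) =
    case_nat (T e) (case_nat (S e) (case_nat (R e) d))" for e
    by (auto simp: fun_eq_iff simp del: mult_Suc_right split: nat.split)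
  then have "sat M (interleave e ?c) E
      (subst (case_nat t (case_nat s (case_nat r (\<lambda>i. Var (Suc (2 * Suc (2 * i))))))) id q) \<longleftrightarrow>
    sat M (case_nat (T e) (case_nat (S e) (case_nat (R e) d))) E q" for e
    by (simp only: sat_subst id_apply)
  then have "rep_fm ?c E (\<lambda>e. sat M (case_nat (T e) (case_nat (S e) (case_nat (R e) d))) E q)"
    unfolding rep_fm_def using subst_bounded_fms[OF assms(1)] by blast
  then show ?thesis using assms(2) unfolding delta0_def by blast
qed

text \<open>
  The converse passage, from a definable predicate back to a formula to which an axiom scheme
  applies; all parameters move into the assignment \<open>e\<close>.
\<close>

lemma sigma02_rep:
  assumes "delta0 (\<lambda>e. P (e 2) (e 1) (e 0))"
  shows "\<exists>p\<in>Sigma0 2. \<exists>E e. range E \<subseteq> Sets M \<and>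
    (\<forall>n. sat M (case_nat n e) E p \<longleftrightarrow> (\<exists>b. \<forall>x. P n b x))"
proof -
  obtain c E p where E: "range E \<subseteq> Sets M" "p \<in> bounded_fms"
    "\<And>e. sat M (interleave e c) E p \<longleftrightarrow> P (e 2) (e 1) (e 0)"
    using assms unfolding delta0_def rep_fm_def by blast
  let ?s = "interleave (case_nat (Var 0) (case_nat (Var 1) (\<lambda>_. Var 2))) (\<lambda>i. Var (i + 3))"
  let ?p = "Ex (All (subst ?s id p))"
  have "(\<lambda>i. val M (case_nat x (case_nat b (case_nat n c))) (?s i)) =
      interleave (case_nat x (case_nat b (\<lambda>_. n))) c" for n b x
    by (auto simp: fun_eq_iff interleave_def numeral_eq_Suc split: nat.split)
  then have "sat M (case_nat n c) E ?p \<longleftrightarrow> (\<exists>b. \<forall>x. P n b x)" for n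
    by (simp add: sat_subst E numeral_eq_Suc)
  moreover have "?p \<in> Sigma0 2"
    using subst_bounded_fms[OF E(2)] by (simp add: numeral_eq_Suc)
  ultimately show ?thesis using E(1) by blast
qed

lemma delta0_rep:
  assumes "delta0 (\<lambda>e. P (e 0))"
  shows "\<exists>p\<in>bounded_fms. \<exists>E e. range E \<subseteq> Sets M \<and>
    (\<forall>n. sat M (case_nat n e) E p \<longleftrightarrow> P n)"
proof -
  obtain c E p where E: "range E \<subseteq> Sets M" "p \<in> bounded_fms"
    "\<And>e. sat M (interleave e c) E p \<longleftrightarrow> P (e 0)"
    using assms unfolding delta0_def rep_fm_def by blast
  let ?s = "interleave (\<lambda>_. Var 0) (\<lambda>i. Var (Suc i))"
  have "(\<lambda>i. val M (case_nat n c) (?s i)) = interleave (\<lambda>_. n) c" for n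
    by (auto simp: fun_eq_iff interleave_def)
  then have "sat M (case_nat n c) E (subst ?s id p) \<longleftrightarrow> P n" for n
    by (simp add: sat_subst E)
  then show ?thesis using E(1) subst_bounded_fms[OF E(2)] by blast
qed

end

section \<open>Discretely ordered semirings from bounded induction\<close>

locale rca0_star = nonempty_model +
  assumes models: "models M RCA0_star"
begin

abbreviation nat_zero ("\<zero>") where "\<zero> \<equiv> zero M"
abbreviation nat_one ("\<one>") where "\<one> \<equiv> one M"
abbreviation nat_add (infixl "\<oplus>" 65) where "x \<oplus> y \<equiv> add M x y"
abbreviation nat_mul (infixl "\<otimes>" 70) where "x \<otimes> y \<equiv> mul M x y"
abbreviation nat_less (infix "\<prec>" 50) where "x \<prec> y \<equiv> less M x y"
definition nat_le (infix "\<preceq>" 50) where "x \<preceq> y \<longleftrightarrow> x \<prec> y \<or> x = y"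
abbreviation code_pair :: "'a \<Rightarrow> 'a \<Rightarrow> 'a" where "code_pair i j \<equiv> (i \<oplus> j) \<otimes> (i \<oplus> j) \<oplus> i"

lemma sat_axiom: "p \<in> RCA0_star \<Longrightarrow> range E \<subseteq> Sets M \<Longrightarrow> sat M e E p"
  using models unfolding models_def by blast

lemma sat_arith_axiom:
  assumes "p \<in> basic_axioms \<union> exp_axioms"
  shows "sat M (case_nat x (\<lambda>_. y)) (\<lambda>_. SOME A. A \<in> Sets M) p"
proof (rule sat_axiom)
  show "p \<in> RCA0_star" using assms by (simp add: RCA0_star_def)
  have "(SOME A. A \<in> Sets M) \<in> Sets M" using Sets_nonempty by (simp add: some_in_eq)
  then show "range (\<lambda>_::nat. SOME A. A \<in> Sets M) \<subseteq> Sets M" by blast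
qed

lemma succ_ne_zero: "x \<oplus> \<one> \<noteq> \<zero>"
  using sat_arith_axiom[of "Neg (Eq (Add (Var 0) One) Zero)" x]
  by (simp add: basic_axioms_def)

lemma succ_inject: "x \<oplus> \<one> = y \<oplus> \<one> \<Longrightarrow> x = y"
  using sat_arith_axiom[of "Imp (Eq (Add (Var 0) One) (Add (Var 1) One)) (Eq (Var 0) (Var 1))" x y]
  by (simp add: basic_axioms_def)

lemma add_zero: "x \<oplus> \<zero> = x"
  using sat_arith_axiom[of "Eq (Add (Var 0) Zero) (Var 0)" x] by (simp add: basic_axioms_def)

lemma add_succ: "x \<oplus> (y \<oplus> \<one>) = x \<oplus> y \<oplus> \<one>"
  using sat_arith_axiom[of "Eq (Add (Var 0) (Add (Var 1) One)) (Add (Add (Var 0) (Var 1)) One)" x y]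
  by (simp add: basic_axioms_def)

lemma mul_zero: "x \<otimes> \<zero> = \<zero>"
  using sat_arith_axiom[of "Eq (Mul (Var 0) Zero) Zero" x] by (simp add: basic_axioms_def)

lemma mul_succ: "x \<otimes> (y \<oplus> \<one>) = x \<otimes> y \<oplus> x"
  using sat_arith_axiom[of
      "Eq (Mul (Var 0) (Add (Var 1) One)) (Add (Mul (Var 0) (Var 1)) (Var 0))" x y]
  by (simp add: basic_axioms_def)

lemma not_less_zero: "\<not> x \<prec> \<zero>"
  using sat_arith_axiom[of "Neg (Less (Var 0) Zero)" x] by (simp add: basic_axioms_def)

lemma less_succ: "x \<prec> y \<oplus> \<one> \<longleftrightarrow> x \<preceq> y"
  using sat_arith_axiom[of "Iff (Less (Var 0) (Add (Var 1) One))
      (Disj (Less (Var 0) (Var 1)) (Eq (Var 0) (Var 1)))" x y]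
  by (simp add: basic_axioms_def nat_le_def)

lemma exp_zero: "exp M x \<zero> = \<one>"
  using sat_arith_axiom[of "Eq (Exp (Var 0) Zero) One" x] by (simp add: exp_axioms_def)

lemma exp_succ: "exp M x (y \<oplus> \<one>) = exp M x y \<otimes> x"
  using sat_arith_axiom[of
      "Eq (Exp (Var 0) (Add (Var 1) One)) (Mul (Exp (Var 0) (Var 1)) (Var 0))" x y]
  by (simp add: exp_axioms_def)

lemma delta0_induct:
  assumes "delta0 (\<lambda>e. P (e 0))" and "P \<zero>" and "\<And>n. P n \<Longrightarrow> P (n \<oplus> \<one>)"
  shows "P n"
proof -
  obtain p E e where p: "p \<in> bounded_fms" "range E \<subseteq> Sets M"
    "\<And>n. sat M (case_nat n e) E p \<longleftrightarrow> P n"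
    using delta0_rep[of P, OF assms(1)] by blast
  have "sat M e E (induction_axiom p)"
    using p by (intro sat_axiom) (auto simp: RCA0_star_def induction_scheme_def)
  then show ?thesis using assms(2,3) by (simp add: sat_induction_axiom p)
qed

lemma delta0_comprehension:
  assumes "delta0 (\<lambda>e. P (e 0))"
  shows "{n. P n} \<in> Sets M"
proof -
  obtain p E e where p: "p \<in> bounded_fms" "range E \<subseteq> Sets M"
    "\<And>n. sat M (case_nat n e) E p \<longleftrightarrow> P n"
    using delta0_rep[of P, OF assms] by blast
  \<comment> \<open>Dummy quantifiers make the bounded formula both \<open>\<Sigma>\<^sup>0\<^sub>1\<close> and \<open>\<Pi>\<^sup>0\<^sub>1\<close>.\<close>
  let ?p = "subst (\<lambda>i. Var (Suc i)) id p"
  have q: "?p \<in> bounded_fms" using p(1) by (rule subst_bounded_fms)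
  have "sat M e E (comprehension_axiom (Ex ?p) (All ?p))"
    using q p(2) by (intro sat_axiom) (auto simp: RCA0_star_def Delta01_comprehension_def)
  then show ?thesis by (simp add: sat_comprehension_axiom sat_subst p)
qed

lemma zero_add: "\<zero> \<oplus> x = x"
  by (rule delta0_induct[where P = "\<lambda>x. \<zero> \<oplus> x = x"])
    (intro delta0_intros, simp_all add: add_zero add_succ)

lemma add_assoc': "x \<oplus> y \<oplus> z = x \<oplus> (y \<oplus> z)"
  by (rule delta0_induct[where P = "\<lambda>z. x \<oplus> y \<oplus> z = x \<oplus> (y \<oplus> z)"])
    (intro delta0_intros, simp_all add: add_zero add_succ)

lemma succ_add: "(x \<oplus> \<one>) \<oplus> y = x \<oplus> y \<oplus> \<one>"
  by (rule delta0_induct[where P = "\<lambda>y. (x \<oplus> \<one>) \<oplus> y = x \<oplus> y \<oplus> \<one>"])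
    (intro delta0_intros, simp_all add: add_zero add_succ)

lemma add_commute': "x \<oplus> y = y \<oplus> x"
  by (rule delta0_induct[where P = "\<lambda>y. x \<oplus> y = y \<oplus> x"])
    (intro delta0_intros, simp_all add: add_zero add_succ zero_add succ_add)

lemma zero_mul: "\<zero> \<otimes> x = \<zero>"
  by (rule delta0_induct[where P = "\<lambda>x. \<zero> \<otimes> x = \<zero>"])
    (intro delta0_intros, simp_all add: mul_zero mul_succ add_zero)

lemma mul_one: "x \<otimes> \<one> = x"
  using mul_succ[of x \<zero>] by (simp add: mul_zero zero_add)

lemma succ_mul: "(x \<oplus> \<one>) \<otimes> y = x \<otimes> y \<oplus> y"
proof (rule delta0_induct[where P = "\<lambda>y. (x \<oplus> \<one>) \<otimes> y = x \<otimes> y \<oplus> y"])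
  fix n assume "(x \<oplus> \<one>) \<otimes> n = x \<otimes> n \<oplus> n"
  then have "(x \<oplus> \<one>) \<otimes> (n \<oplus> \<one>) = x \<otimes> n \<oplus> (n \<oplus> x) \<oplus> \<one>"
    by (simp only: mul_succ add_assoc')
  also have "\<dots> = x \<otimes> (n \<oplus> \<one>) \<oplus> (n \<oplus> \<one>)"
    by (simp only: mul_succ add_assoc' add_commute'[of n x])
  finally show "(x \<oplus> \<one>) \<otimes> (n \<oplus> \<one>) = x \<otimes> (n \<oplus> \<one>) \<oplus> (n \<oplus> \<one>)" .
qed (intro delta0_intros, simp add: mul_zero add_zero)

lemma mul_commute': "x \<otimes> y = y \<otimes> x"
  by (rule delta0_induct[where P = "\<lambda>y. x \<otimes> y = y \<otimes> x"])
    (intro delta0_intros, simp_all add: mul_zero mul_succ zero_mul succ_mul)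

lemma distrib: "x \<otimes> (y \<oplus> z) = x \<otimes> y \<oplus> x \<otimes> z"
  by (rule delta0_induct[where P = "\<lambda>z. x \<otimes> (y \<oplus> z) = x \<otimes> y \<oplus> x \<otimes> z"])
    (intro delta0_intros, simp_all add: mul_zero mul_succ add_zero add_assoc'[symmetric])

lemma mul_assoc': "x \<otimes> y \<otimes> z = x \<otimes> (y \<otimes> z)"
  by (rule delta0_induct[where P = "\<lambda>z. x \<otimes> y \<otimes> z = x \<otimes> (y \<otimes> z)"])
    (intro delta0_intros, simp_all add: mul_zero mul_succ distrib mul_one)

lemma add_left_cancel': "x \<oplus> y = x \<oplus> z \<longleftrightarrow> y = z"
proof -
  have "y \<oplus> x = z \<oplus> x \<longrightarrow> y = z"
    by (rule delta0_induct[where P = "\<lambda>x. y \<oplus> x = z \<oplus> x \<longrightarrow> y = z"])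
      (intro delta0_intros, auto simp: add_zero add_succ dest: succ_inject)
  then show ?thesis by (metis add_commute')
qed

lemma delta0_le:
  assumes "definable_trm T" "definable_trm S"
  shows "delta0 (\<lambda>e. T e \<preceq> S e)"
  unfolding nat_le_def by (intro delta0_intros assms)

lemmas delta0_rules = delta0_intros delta0_le

lemma zero_le': "\<zero> \<preceq> x"
  by (rule delta0_induct[where P = "\<lambda>x. \<zero> \<preceq> x"])
    (intro delta0_rules, auto simp: less_succ nat_le_def)

lemma less_add_succ: "x \<prec> x \<oplus> y \<oplus> \<one>"
  by (rule delta0_induct[where P = "\<lambda>y. x \<prec> x \<oplus> y \<oplus> \<one>"])
    (intro delta0_rules, auto simp: add_zero less_succ add_succ nat_le_def)

lemma less_iff_add: "x \<prec> y \<longleftrightarrow> (\<exists>z. y = x \<oplus> z \<oplus> \<one>)"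
proof -
  \<comment> \<open>The bound on \<open>z\<close> is what makes the induction formula bounded.\<close>
  have "x \<prec> y \<longrightarrow> (\<exists>z. z \<prec> y \<and> y = x \<oplus> z \<oplus> \<one>)"
  proof (rule delta0_induct[where P = "\<lambda>y. x \<prec> y \<longrightarrow> (\<exists>z. z \<prec> y \<and> y = x \<oplus> z \<oplus> \<one>)"])
    show "x \<prec> n \<oplus> \<one> \<longrightarrow> (\<exists>z. z \<prec> n \<oplus> \<one> \<and> n \<oplus> \<one> = x \<oplus> z \<oplus> \<one>)"
      if IH: "x \<prec> n \<longrightarrow> (\<exists>z. z \<prec> n \<and> n = x \<oplus> z \<oplus> \<one>)" for n
    proof
      assume "x \<prec> n \<oplus> \<one>"
      then consider "x \<prec> n" | "x = n" by (auto simp: less_succ nat_le_def)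
      then show "\<exists>z. z \<prec> n \<oplus> \<one> \<and> n \<oplus> \<one> = x \<oplus> z \<oplus> \<one>"
      proof cases
        case 1
        then obtain z where "n = x \<oplus> z \<oplus> \<one>" using IH by blast
        then show ?thesis
          by (intro exI[of _ "z \<oplus> \<one>"])
            (metis add_commute' add_succ less_add_succ)
      next
        case 2
        then show ?thesis using zero_le' by (auto simp: add_zero less_succ intro!: exI[of _ \<zero>])
      qed
    qed
  qed (intro delta0_rules, simp add: not_less_zero)
  then show ?thesis using less_add_succ by blast
qed

lemma le_iff_add': "x \<preceq> y \<longleftrightarrow> (\<exists>z. y = x \<oplus> z)"
proof
  assume "\<exists>z. y = x \<oplus> z"
  then obtain z where z: "y = x \<oplus> z" ..
  show "x \<preceq> y"
  proof (cases "z = \<zero>")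
    case False
    then have "\<zero> \<prec> z" using zero_le'[of z] by (auto simp: nat_le_def)
    then obtain w where "z = w \<oplus> \<one>" by (metis less_iff_add zero_add)
    then show ?thesis using z by (metis add_succ less_add_succ nat_le_def)
  qed (simp add: z add_zero nat_le_def)
qed (metis less_iff_add add_zero add_assoc' nat_le_def)

lemma add_eq_zero: "x \<oplus> y = \<zero> \<Longrightarrow> x = \<zero>"
  by (metis le_iff_add' not_less_zero nat_le_def)

lemma less_irrefl': "\<not> x \<prec> x"
proof
  assume "x \<prec> x"
  then obtain z where "x \<oplus> (z \<oplus> \<one>) = x \<oplus> \<zero>" by (metis less_iff_add add_succ add_zero)
  then show False using add_left_cancel' succ_ne_zero by blast
qed

lemma le_antisym': "x \<preceq> y \<Longrightarrow> y \<preceq> x \<Longrightarrow> x = y"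
  by (metis le_iff_add' add_assoc' add_left_cancel' add_eq_zero add_zero)

lemma le_total': "x \<preceq> y \<or> y \<preceq> x"
proof (rule delta0_induct[where P = "\<lambda>y. x \<preceq> y \<or> y \<preceq> x"])
  fix n assume "x \<preceq> n \<or> n \<preceq> x"
  then consider "x \<preceq> n" | "n \<prec> x" by (auto simp: nat_le_def)
  then show "x \<preceq> n \<oplus> \<one> \<or> n \<oplus> \<one> \<preceq> x"
  proof cases
    case 2
    then show ?thesis by (metis le_iff_add' less_iff_add succ_add)
  qed (simp add: less_succ nat_le_def)
qed (intro delta0_rules, use zero_le' in auto)

text \<open>
  Truncated subtraction belongs to the signature of the type class of ordered semidomains; it is
  introduced to make the model an instance.
\<close>

definition monus (infixl "\<ominus>" 65) where
  "x \<ominus> y = (if y \<preceq> x then THE z. x = y \<oplus> z else \<zero>)"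

lemma monus_add: "x \<oplus> y \<ominus> x = y"
  unfolding monus_def using le_iff_add' by (auto simp: add_left_cancel')

lemma monus_eq_zero: "x \<preceq> y \<Longrightarrow> x \<ominus> y = \<zero>"
  by (metis add_zero le_antisym' monus_add monus_def)

lemma monus_monus: "x \<ominus> y \<ominus> z = x \<ominus> (y \<oplus> z)"
proof (cases "y \<preceq> x")
  case True
  then obtain w where w: "x = y \<oplus> w" using le_iff_add' by blast
  show ?thesis
  proof (cases "z \<preceq> w")
    case True
    then obtain v where "w = z \<oplus> v" using le_iff_add' by blast
    then have "x = (y \<oplus> z) \<oplus> v" "w \<ominus> z = v" by (simp_all add: w add_assoc' monus_add)
    then show ?thesis by (simp only: w monus_add) (metis monus_add)
  next
    case False
    then have "w \<preceq> z" using le_total' by blast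
    moreover from this obtain v where "z = w \<oplus> v" using le_iff_add' by blast
    then have "x \<preceq> y \<oplus> z" unfolding le_iff_add' w by (auto simp: add_assoc')
    ultimately show ?thesis using w by (simp add: monus_eq_zero monus_add)
  qed
next
  case False
  then have "x \<preceq> y" using le_total' by blast
  moreover from this obtain v where "y = x \<oplus> v" using le_iff_add' by blast
  then have "x \<preceq> y \<oplus> z" unfolding le_iff_add' by (auto simp: add_assoc')
  ultimately show ?thesis by (simp add: monus_eq_zero zero_le')
qed

lemma mul_mono': "x \<preceq> y \<Longrightarrow> z \<otimes> x \<preceq> z \<otimes> y"
  by (auto simp: le_iff_add' distrib)

lemma mul_monus: "x \<otimes> (y \<ominus> z) = x \<otimes> y \<ominus> x \<otimes> z"
proof (cases "z \<preceq> y")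
  case True
  then show ?thesis by (auto simp: le_iff_add' distrib monus_add)
next
  case False
  then have "y \<preceq> z" using le_total' by blast
  then show ?thesis by (simp add: mul_mono' monus_eq_zero mul_zero)
qed

lemma ne_zero_succ: "x \<noteq> \<zero> \<Longrightarrow> \<exists>y. x = y \<oplus> \<one>"
  using zero_le'[of x] less_iff_add[of \<zero> x] by (auto simp: nat_le_def zero_add)

lemma mul_strict_mono':
  assumes "x \<prec> y" "\<zero> \<prec> z"
  shows "z \<otimes> x \<prec> z \<otimes> y"
proof -
  obtain u v where "y = x \<oplus> (u \<oplus> \<one>)" "z = v \<oplus> \<one>"
    using assms by (auto simp: less_iff_add zero_add add_succ)
  then have "z \<otimes> y = z \<otimes> x \<oplus> (z \<otimes> u \<oplus> v) \<oplus> \<one>"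
    by (simp only: distrib mul_one add_assoc')
  then show ?thesis unfolding less_iff_add by blast
qed

text \<open>
  From here on the algebraic and order lemmas of the class are available for the model, under the
  prefix \<open>N\<close>, and its simplification rules are active.
\<close>

sublocale N: linordered_semidom where plus = "(\<oplus>)" and zero = \<zero> and minus = "(\<ominus>)"
    and times = "(\<otimes>)" and one = \<one> and less_eq = "(\<preceq>)" and less = "(\<prec>)"
proof
  fix a b c
  show "\<zero> \<noteq> \<one>" by (metis succ_ne_zero zero_add)
  show "a \<noteq> \<zero> \<Longrightarrow> b \<noteq> \<zero> \<Longrightarrow> a \<otimes> b \<noteq> \<zero>"
    by (metis ne_zero_succ mul_succ add_succ succ_ne_zero)
  show "\<zero> \<prec> \<one>" by (metis less_iff_add zero_add)
  show "b \<preceq> a \<Longrightarrow> a \<ominus> b \<oplus> b = a" by (metis le_iff_add' monus_add add_commute')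
  show "a \<prec> b \<longleftrightarrow> a \<preceq> b \<and> \<not> b \<preceq> a"
    using le_antisym'[of a b] less_irrefl'[of a] by (auto simp: nat_le_def)
  show "a \<preceq> a" by (simp add: nat_le_def)
  show "a \<preceq> b \<Longrightarrow> b \<preceq> c \<Longrightarrow> a \<preceq> c" by (auto simp: le_iff_add' add_assoc')
  show "a \<preceq> b \<Longrightarrow> c \<oplus> a \<preceq> c \<oplus> b" by (auto simp: le_iff_add' add_assoc')
  show "\<one> \<otimes> a = a" by (metis mul_succ mul_zero zero_add mul_commute')
  show "(a \<oplus> b) \<otimes> c = a \<otimes> c \<oplus> b \<otimes> c" by (metis distrib mul_commute')
qed (fact add_assoc' add_commute' monus_add zero_add zero_mul mul_assoc' mul_commute'
    le_antisym' le_total' mul_zero distrib monus_monus mul_monus mul_strict_mono')+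

lemma succ_le_iff: "x \<oplus> \<one> \<preceq> y \<longleftrightarrow> x \<prec> y"
  using less_succ[of x y] less_succ[of y x] by (metis N.not_le)

section \<open>Extremal elements, division and pairing\<close>

lemma delta0_least:
  assumes "delta0 (\<lambda>e. P (e 0))" "P a"
  shows "\<exists>m. P m \<and> (\<forall>x. x \<prec> m \<longrightarrow> \<not> P x)"
proof (rule ccontr)
  assume none: "\<nexists>m. P m \<and> (\<forall>x. x \<prec> m \<longrightarrow> \<not> P x)"
  have "\<forall>x. x \<prec> n \<longrightarrow> \<not> P x" for n
  proof (rule delta0_induct[where P = "\<lambda>n. \<forall>x. x \<prec> n \<longrightarrow> \<not> P x"])
    show "\<forall>x. x \<prec> n \<oplus> \<one> \<longrightarrow> \<not> P x" if "\<forall>x. x \<prec> n \<longrightarrow> \<not> P x" for n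
      using that none unfolding less_succ nat_le_def by blast
  qed (intro delta0_rules assms(1), simp add: not_less_zero)
  then have "\<not> P a" using less_succ[of a a] by blast
  with assms(2) show False by contradiction
qed

text \<open>
  Apply the least number principle to the strict upper bounds: the least one is a successor, and
  its predecessor is the maximum. The bound \<open>w\<close> keeps the quantifier in the notion of upper bound
  bounded.
\<close>

lemma delta0_greatest:
  assumes "delta0 (\<lambda>e. P (e 0))" "P a" "\<And>x. P x \<Longrightarrow> x \<prec> w"
  shows "\<exists>m. P m \<and> (\<forall>x. m \<prec> x \<longrightarrow> \<not> P x)"
proof -
  let ?B = "\<lambda>u. \<forall>x. x \<prec> w \<longrightarrow> P x \<longrightarrow> x \<prec> u"
  have "delta0 (\<lambda>e. ?B (e 0))" by (intro delta0_rules assms(1))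
  moreover have "?B w" by blast
  ultimately obtain u where u: "?B u" and least: "\<And>x. x \<prec> u \<Longrightarrow> \<not> ?B x"
    using delta0_least[of ?B w] by blast
  have "a \<prec> u" using u assms(2,3) by blast
  then have "u \<noteq> \<zero>" using not_less_zero by blast
  then obtain m where m: "u = m \<oplus> \<one>" using ne_zero_succ by blast
  then have "m \<prec> u" by (simp add: less_succ)
  then obtain x where "P x" "\<not> x \<prec> m" using least by blast
  moreover have "x \<preceq> m" if "P x" for x using u assms(3) that m less_succ by blast
  ultimately have "P m" by (metis nat_le_def)
  moreover have "\<not> P x" if "m \<prec> x" for x
    using \<open>\<And>x. P x \<Longrightarrow> x \<preceq> m\<close> that N.not_le by blast
  ultimately show ?thesis by blast
qed

lemma division:
  assumes "\<zero> \<prec> n"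
  obtains q r where "w = q \<otimes> n \<oplus> r" "r \<prec> n"
proof -
  have "\<exists>q. q \<prec> w \<oplus> \<one> \<and> (\<exists>r. r \<prec> n \<and> w = q \<otimes> n \<oplus> r)"
  proof (rule delta0_induct[where P = "\<lambda>w. \<exists>q. q \<prec> w \<oplus> \<one> \<and> (\<exists>r. r \<prec> n \<and> w = q \<otimes> n \<oplus> r)"])
    show "\<exists>q. q \<prec> \<zero> \<oplus> \<one> \<and> (\<exists>r. r \<prec> n \<and> \<zero> = q \<otimes> n \<oplus> r)"
      using assms by (intro exI[of _ \<zero>]) (simp add: less_succ)
  next
    fix w assume "\<exists>q. q \<prec> w \<oplus> \<one> \<and> (\<exists>r. r \<prec> n \<and> w = q \<otimes> n \<oplus> r)"
    then obtain q r where *: "q \<preceq> w" "r \<prec> n" "w = q \<otimes> n \<oplus> r" by (auto simp: less_succ)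
    show "\<exists>q. q \<prec> w \<oplus> \<one> \<oplus> \<one> \<and> (\<exists>r. r \<prec> n \<and> w \<oplus> \<one> = q \<otimes> n \<oplus> r)"
    proof (cases "r \<oplus> \<one> = n")
      case True
      then have "w \<oplus> \<one> = (q \<oplus> \<one>) \<otimes> n \<oplus> \<zero>"
        using *(3) by (simp add: add_assoc' succ_mul)
      moreover have "q \<oplus> \<one> \<preceq> w \<oplus> \<one>" using * by simp
      ultimately show ?thesis using assms unfolding less_succ by blast
    next
      case False
      then have "r \<oplus> \<one> \<prec> n" using *(2) by (simp add: succ_le_iff N.less_le)
      moreover have "w \<oplus> \<one> = q \<otimes> n \<oplus> (r \<oplus> \<one>)" using * by (simp add: algebra_simps)
      moreover have "q \<preceq> w \<oplus> \<one>" using * N.le_less_trans[of q w "w \<oplus> \<one>"] less_succ[of w w]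
        by (simp add: N.less_imp_le)
      ultimately show ?thesis unfolding less_succ by blast
    qed
  qed (intro delta0_rules)
  then show ?thesis using that by blast
qed

lemma division_less:
  assumes "q \<prec> q'" "r \<prec> n"
  shows "q \<otimes> n \<oplus> r \<prec> q' \<otimes> n \<oplus> r'"
proof -
  have "q \<otimes> n \<oplus> r \<prec> (q \<oplus> \<one>) \<otimes> n" using assms(2) by (simp add: algebra_simps)
  also have "\<dots> \<preceq> q' \<otimes> n"
    using assms(1) by (intro N.mult_right_mono) (simp_all add: succ_le_iff zero_le')
  also have "\<dots> \<preceq> q' \<otimes> n \<oplus> r'" by (simp add: zero_le')
  finally show ?thesis .
qed

lemma division_unique:
  assumes "q \<otimes> n \<oplus> r = q' \<otimes> n \<oplus> r'" "r \<prec> n" "r' \<prec> n"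
  shows "q = q' \<and> r = r'"
proof -
  have "q = q'"
    using division_less[of q q' r n r'] division_less[of q' q r' n r] assms
    by (metis N.less_irrefl N.linorder_cases)
  then show ?thesis using assms(1) by simp
qed

lemma le_mul_self: "x \<preceq> x \<otimes> x"
proof (cases "x = \<zero>")
  case False
  then obtain y where "x = y \<oplus> \<one>" using ne_zero_succ by blast
  then have "x \<otimes> x = x \<oplus> x \<otimes> y" by (simp add: distrib mul_one add_commute')
  then show ?thesis by (simp add: zero_le')
qed simp

lemma code_pair_bounds: "i \<preceq> code_pair i j" "j \<preceq> code_pair i j"
proof -
  show "i \<preceq> code_pair i j" by (simp add: zero_le')
  have "j \<preceq> i \<oplus> j" by (simp add: zero_le')
  also have "\<dots> \<preceq> (i \<oplus> j) \<otimes> (i \<oplus> j)" by (rule le_mul_self)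
  also have "\<dots> \<preceq> code_pair i j" by (simp add: zero_le')
  finally show "j \<preceq> code_pair i j" .
qed

text \<open>
  The pairs on the diagonal \<open>i + j = s\<close> have their codes in \<open>[s\<^sup>2, s\<^sup>2 + s]\<close>, which lies below
  \<open>(s + 1)\<^sup>2\<close>.
\<close>

lemma code_pair_less:
  assumes "i \<oplus> j \<prec> i' \<oplus> j'"
  shows "code_pair i j \<prec> code_pair i' j'"
proof -
  let ?s = "i \<oplus> j"
  have "i \<preceq> ?s" by (simp add: zero_le')
  then have "code_pair i j \<preceq> ?s \<otimes> ?s \<oplus> ?s" by (rule N.add_left_mono)
  also have "\<dots> \<prec> ?s \<otimes> ?s \<oplus> ?s \<oplus> (?s \<oplus> \<one>)"
    using less_add_succ[of "?s \<otimes> ?s \<oplus> ?s" ?s] by (simp only: add_assoc')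
  also have "\<dots> = (?s \<oplus> \<one>) \<otimes> (?s \<oplus> \<one>)" by (simp add: algebra_simps)
  also have "\<dots> \<preceq> (i' \<oplus> j') \<otimes> (i' \<oplus> j')"
    using assms by (intro N.mult_mono) (simp_all only: succ_le_iff zero_le')
  also have "\<dots> \<preceq> code_pair i' j'" by (simp add: zero_le')
  finally show ?thesis .
qed

lemma code_pair_inject: "code_pair i j = code_pair i' j' \<longleftrightarrow> i = i' \<and> j = j'"
proof
  assume eq: "code_pair i j = code_pair i' j'"
  then have "i \<oplus> j = i' \<oplus> j'"
    using code_pair_less[of i j i' j'] code_pair_less[of i' j' i j]
    by (metis N.less_irrefl N.linorder_cases)
  with eq show "i = i' \<and> j = j'" by simp
qed simp

section \<open>Finite sets coded in binary\<close>

definition pow2 :: "'a \<Rightarrow> 'a" where "pow2 x = exp M (\<one> \<oplus> \<one>) x"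

lemma definable_pow2: "definable_trm T \<Longrightarrow> definable_trm (\<lambda>e. pow2 (T e))"
  unfolding pow2_def by (intro definable_exp definable_const)

lemma pow2_zero: "pow2 \<zero> = \<one>"
  by (simp only: pow2_def exp_zero)

lemma pow2_succ: "pow2 (x \<oplus> \<one>) = pow2 x \<oplus> pow2 x"
  by (simp only: pow2_def exp_succ distrib mul_one)

lemma pow2_pos: "\<zero> \<prec> pow2 x"
  by (rule delta0_induct[where P = "\<lambda>x. \<zero> \<prec> pow2 x"])
    (intro delta0_rules definable_pow2, simp_all add: pow2_zero pow2_succ N.add_pos_pos)

lemma pow2_add: "pow2 (x \<oplus> y) = pow2 x \<otimes> pow2 y"
  by (rule delta0_induct[where P = "\<lambda>y. pow2 (x \<oplus> y) = pow2 x \<otimes> pow2 y"])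
    (intro delta0_rules definable_pow2,
      simp_all add: pow2_zero pow2_succ distrib flip: add_assoc')

text \<open>
  The digit of \<open>s\<close> at \<open>2\<^sup>j\<close> is 1. The bound on the quotient \<open>u\<close> makes the predicate a bounded one; it
  is removed by \<open>bit_iff\<close>.
\<close>

definition bit :: "'a \<Rightarrow> 'a \<Rightarrow> bool" where
  "bit j s \<longleftrightarrow> (\<exists>u. u \<prec> s \<oplus> \<one> \<and> (\<exists>r. r \<prec> pow2 j \<and> s = u \<otimes> pow2 (j \<oplus> \<one>) \<oplus> (pow2 j \<oplus> r)))"

lemma le_mul_add: "\<zero> \<prec> n \<Longrightarrow> q \<preceq> q \<otimes> n \<oplus> r"
proof -
  assume "\<zero> \<prec> n"
  then obtain m where "n = m \<oplus> \<one>" using ne_zero_succ[of n] not_less_zero[of \<zero>] by auto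
  then show ?thesis by (simp add: algebra_simps zero_le')
qed

lemma bit_iff:
  "bit j s \<longleftrightarrow> (\<exists>u r. r \<prec> pow2 j \<and> s = u \<otimes> pow2 (j \<oplus> \<one>) \<oplus> (pow2 j \<oplus> r))"
  unfolding bit_def less_succ using le_mul_add[OF pow2_pos] by blast

lemma not_bit_zero: "\<not> bit j \<zero>"
proof
  assume "bit j \<zero>"
  then obtain u r where "u \<otimes> pow2 (j \<oplus> \<one>) \<oplus> (pow2 j \<oplus> r) = \<zero>" unfolding bit_iff by metis
  then have "pow2 j = \<zero>" by (metis add_commute' add_eq_zero)
  then show False using pow2_pos[of j] by simp
qed

lemma pow2_dvd:
  assumes "i \<preceq> j"
  obtains d where "pow2 j = d \<otimes> pow2 i"
  using assms unfolding le_iff_add' by (metis pow2_add mul_commute')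

text \<open>
  If digit \<open>j\<close> of \<open>s\<close> is 0, then adding \<open>2\<^sup>j\<close> causes no carry, so it does not lift the remainder \<open>v\<close>
  of \<open>s\<close> modulo a higher power \<open>2\<^sup>i\<close> to \<open>2\<^sup>i\<close>. Indeed \<open>v\<close> is \<open>c 2\<^sup>j\<^sup>+\<^sup>1 + r\<close> with \<open>c < d\<close>, where
  \<open>2\<^sup>i = d 2\<^sup>j\<^sup>+\<^sup>1\<close>, and \<open>r + 2\<^sup>j\<close> is still less than \<open>2\<^sup>j\<^sup>+\<^sup>1\<close>.
\<close>

lemma add_pow2_no_carry:
  assumes s: "s = q \<otimes> pow2 (j \<oplus> \<one>) \<oplus> r" "r \<prec> pow2 j" and "j \<prec> i"
    and uv: "s = u \<otimes> pow2 i \<oplus> v" "v \<prec> pow2 i"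
  shows "v \<oplus> pow2 j \<prec> pow2 i"
proof -
  let ?p = "pow2 (j \<oplus> \<one>)"
  obtain d where d: "pow2 i = d \<otimes> ?p" using assms(3) pow2_dvd succ_le_iff by metis
  obtain c r' where c: "v = c \<otimes> ?p \<oplus> r'" "r' \<prec> ?p" using division[OF pow2_pos] by metis
  have "r \<prec> ?p"
    using s(2) N.less_add_same_cancel1[of "pow2 j" "pow2 j"] pow2_pos[of j]
    unfolding pow2_succ by (metis N.less_trans)
  moreover have "q \<otimes> ?p \<oplus> r = (u \<otimes> d \<oplus> c) \<otimes> ?p \<oplus> r'"
    using s(1) uv(1) c(1) d by (simp add: algebra_simps)
  ultimately have "r' = r" using division_unique c(2) by blast
  have "c \<prec> d"
  proof (rule ccontr)
    assume "\<not> c \<prec> d"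
    then have "d \<otimes> ?p \<preceq> c \<otimes> ?p" by (intro N.mult_right_mono) (simp_all add: zero_le' N.not_less)
    also have "\<dots> \<preceq> v" by (simp add: c(1) zero_le')
    finally show False using uv(2) d N.not_le by metis
  qed
  moreover have "r \<oplus> pow2 j \<prec> ?p" using s(2) unfolding pow2_succ by simp
  ultimately have "c \<otimes> ?p \<oplus> (r \<oplus> pow2 j) \<prec> d \<otimes> ?p \<oplus> \<zero>" by (rule division_less)
  then show ?thesis unfolding c(1) d \<open>r' = r\<close> by (simp add: add_assoc')
qed

lemma less_double_cases:
  assumes "r \<prec> n \<oplus> n"
  shows "r \<prec> n \<or> (\<exists>t. t \<prec> n \<and> r = n \<oplus> t)"
proof (cases "r \<prec> n")
  case False
  then obtain t where "r = n \<oplus> t" using le_iff_add' N.not_less by metis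
  then show ?thesis using assms by auto
qed simp

text \<open>
  Adding \<open>2\<^sup>j\<close> inserts \<open>j\<close> into the set coded by \<open>s\<close>. For a digit \<open>i < j\<close> compare remainders modulo
  \<open>2\<^sup>i\<^sup>+\<^sup>1\<close>, which divides \<open>2\<^sup>j\<close>; for \<open>i > j\<close> there is no carry modulo \<open>2\<^sup>i\<^sup>+\<^sup>1\<close>, and none modulo \<open>2\<^sup>i\<close>
  either, so a remainder below \<open>2\<^sup>i\<close> cannot be pushed up to \<open>2\<^sup>i\<close>.
\<close>

lemma insert_bit:
  assumes nb: "\<not> bit j s" and "s \<prec> pow2 k" "j \<prec> k"
  shows "s \<oplus> pow2 j \<prec> pow2 k"
    and "bit i (s \<oplus> pow2 j) \<Longrightarrow> bit i s \<or> i = j"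
proof -
  obtain q r where qr: "s = q \<otimes> pow2 (j \<oplus> \<one>) \<oplus> r" "r \<prec> pow2 (j \<oplus> \<one>)"
    using division[OF pow2_pos] by metis
  \<comment> \<open>The remainder is below \<open>2\<^sup>j\<^sup>+\<^sup>1\<close>; the missing digit \<open>j\<close> halves the bound.\<close>
  have r: "r \<prec> pow2 j"
    using less_double_cases[of r "pow2 j"] qr nb unfolding pow2_succ bit_iff by metis
  note no_carry = add_pow2_no_carry[OF qr(1) r]
  show "s \<oplus> pow2 j \<prec> pow2 k"
    using no_carry[OF assms(3), of \<zero> s] assms(2) by simp
  assume "bit i (s \<oplus> pow2 j)"
  then obtain u t where t: "t \<prec> pow2 i" "s \<oplus> pow2 j = u \<otimes> pow2 (i \<oplus> \<one>) \<oplus> (pow2 i \<oplus> t)"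
    unfolding bit_iff by blast
  have t': "pow2 i \<oplus> t \<prec> pow2 (i \<oplus> \<one>)" using t(1) by (simp add: pow2_succ)
  obtain a b where ab: "s = a \<otimes> pow2 (i \<oplus> \<one>) \<oplus> b" "b \<prec> pow2 (i \<oplus> \<one>)"
    using division[OF pow2_pos] by metis
  consider "i \<prec> j" | "i = j" | "j \<prec> i" using N.linorder_cases by blast
  then show "bit i s \<or> i = j"
  proof cases
    case 1
    then obtain d where d: "pow2 j = d \<otimes> pow2 (i \<oplus> \<one>)" using pow2_dvd succ_le_iff by metis
    have "(a \<oplus> d) \<otimes> pow2 (i \<oplus> \<one>) \<oplus> b = u \<otimes> pow2 (i \<oplus> \<one>) \<oplus> (pow2 i \<oplus> t)"
      using ab(1) d t(2) by (simp add: algebra_simps)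
    then have "b = pow2 i \<oplus> t" using division_unique ab(2) t' by blast
    then show ?thesis using ab(1) t(1) unfolding bit_iff by blast
  next
    case 3
    then have "j \<prec> i \<oplus> \<one>" by (simp add: less_succ N.less_imp_le)
    then have "b \<oplus> pow2 j \<prec> pow2 (i \<oplus> \<one>)" using no_carry ab by blast
    moreover have "a \<otimes> pow2 (i \<oplus> \<one>) \<oplus> (b \<oplus> pow2 j) = u \<otimes> pow2 (i \<oplus> \<one>) \<oplus> (pow2 i \<oplus> t)"
      using ab(1) t(2) by (simp add: algebra_simps)
    ultimately have eq: "b \<oplus> pow2 j = pow2 i \<oplus> t" using division_unique t' by blast
    have "\<not> b \<prec> pow2 i"
    proof
      assume "b \<prec> pow2 i"
      moreover have "s = (a \<oplus> a) \<otimes> pow2 i \<oplus> b"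
        using ab(1) by (simp add: pow2_succ algebra_simps)
      ultimately have "b \<oplus> pow2 j \<prec> pow2 i" using no_carry 3 by blast
      then show False using eq N.not_less[of "pow2 i \<oplus> t" "pow2 i"] by (simp add: zero_le')
    qed
    then show ?thesis
      using less_double_cases[of b "pow2 i"] ab unfolding pow2_succ bit_iff by metis
  qed simp
qed


lemma delta0_bit:
  assumes "definable_trm T" "definable_trm S"
  shows "delta0 (\<lambda>e. bit (T e) (S e))"
  unfolding bit_def by (intro delta0_rules definable_pow2 assms[THEN definable_reindex])

section \<open>From induction to eventually recurring colours\<close>

lemma models_ECT_iff:
  "models M {ECT} \<longleftrightarrow>
    (\<forall>k. \<forall>f\<in>Sets M.
      (\<forall>n\<in>f. \<exists>i j. n = code_pair i j \<and> j \<prec> k) \<and> (\<forall>i. \<exists>!j. code_pair i j \<in> f) \<longrightarrow>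
      (\<exists>b. \<forall>x. b \<preceq> x \<longrightarrow>
        (\<exists>y. x \<prec> y \<and> (\<exists>v. code_pair x v \<in> f \<and> code_pair y v \<in> f))))"
  (is "_ \<longleftrightarrow> ?R")
proof -
  define R where "R \<longleftrightarrow> ?R"
  have sat: "sat M e E ECT \<longleftrightarrow> R" for e E unfolding sat_ECT R_def nat_le_def ..
  obtain A where "A \<in> Sets M" using Sets_nonempty by blast
  then have "range (\<lambda>_::nat. A) \<subseteq> Sets M" by blast
  then have "models M {ECT} \<longleftrightarrow> R" unfolding models_def by (auto simp: sat)
  then show ?thesis unfolding R_def .
qed

lemma sigma02_induct:
  assumes "models M ISigma02" and "delta0 (\<lambda>e. P (e 2) (e 1) (e 0))"
    and "\<exists>b. \<forall>x. P \<zero> b x" and "\<And>n. \<exists>b. \<forall>x. P n b x \<Longrightarrow> \<exists>b. \<forall>x. P (n \<oplus> \<one>) b x"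
  shows "\<exists>b. \<forall>x. P n b x"
proof -
  define Q where "Q n \<longleftrightarrow> (\<exists>b. \<forall>x. P n b x)" for n
  obtain p E e where p: "p \<in> Sigma0 2" "range E \<subseteq> Sets M"
    "\<And>n. sat M (case_nat n e) E p \<longleftrightarrow> Q n"
    using sigma02_rep[of P, OF assms(2), folded Q_def] by blast
  have "induction_axiom p \<in> ISigma02"
    unfolding ISigma02_def induction_scheme_def using p(1) by (rule imageI)
  then have "sat M e E (induction_axiom p)"
    using assms(1) p(2) unfolding models_def by blast
  then have "Q \<zero> \<Longrightarrow> (\<And>n. Q n \<Longrightarrow> Q (n \<oplus> \<one>)) \<Longrightarrow> Q n"
    unfolding sat_induction_axiom p(3) by blast
  then show ?thesis using assms(3,4) unfolding Q_def by blast
qed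

text \<open>
  Contradicting ECT means that every \<open>w\<close> is followed by a last occurrence of some colour. Then a code
  whose members do not occur from \<open>w\<close> on is never the greatest one below \<open>2\<^sup>k\<close>.
\<close>

lemma ECT_if_ISigma02:
  assumes "models M ISigma02"
  shows "models M {ECT}"
  unfolding models_ECT_iff
proof (intro allI ballI impI, elim conjE, rule ccontr)
  fix k f
  assume f: "f \<in> Sets M" and rng: "\<forall>n\<in>f. \<exists>i j. n = code_pair i j \<and> j \<prec> k"
    and fn: "\<forall>i. \<exists>!j. code_pair i j \<in> f"
    and none: "\<nexists>b. \<forall>x. b \<preceq> x \<longrightarrow> (\<exists>y. x \<prec> y \<and> (\<exists>v. code_pair x v \<in> f \<and> code_pair y v \<in> f))"
  have last: "\<exists>x. w \<preceq> x \<and> (\<forall>y v. x \<prec> y \<longrightarrow> code_pair x v \<in> f \<longrightarrow> code_pair y v \<notin> f)" for w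
    using none by blast
  define N where "N = pow2 k"
  define clear where
    "clear s w \<longleftrightarrow> (\<forall>x v. w \<preceq> x \<longrightarrow> v \<prec> k \<longrightarrow> code_pair x v \<in> f \<longrightarrow> \<not> bit v s)" for s w
  \<comment> \<open>A \<open>\<Sigma>\<^sup>0\<^sub>2\<close> induction formula has one unbounded existential quantifier, but both \<open>w\<close> and \<open>s\<close>
    are to be found. So \<open>s\<close> is packed into \<open>w\<close> as its remainder modulo \<open>2\<^sup>k\<close>; this is possible since
    \<open>w\<close> may be enlarged.\<close>
  define P where "P n w x \<longleftrightarrow> (\<forall>s. s \<prec> N \<longrightarrow> (\<forall>b. b \<prec> w \<oplus> \<one> \<longrightarrow> w = b \<otimes> N \<oplus> s \<longrightarrow>
    n \<preceq> s \<and> (w \<preceq> x \<longrightarrow> (\<forall>v. v \<prec> k \<longrightarrow> code_pair x v \<in> f \<longrightarrow> \<not> bit v s))))" for n w x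
  have N: "\<zero> \<prec> N" unfolding N_def by (rule pow2_pos)
  \<comment> \<open>From right to left, \<open>w N + s\<close> is the packed witness; it is at least \<open>w\<close> since \<open>N > 0\<close>.\<close>
  have P_iff: "(\<exists>w. \<forall>x. P n w x) \<longleftrightarrow> (\<exists>w s. s \<prec> N \<and> n \<preceq> s \<and> clear s w)" for n
  proof
    assume "\<exists>w. \<forall>x. P n w x"
    then obtain w where w: "\<And>x. P n w x" by blast
    obtain b s where bs: "w = b \<otimes> N \<oplus> s" "s \<prec> N" using division[OF N] by metis
    have "b \<preceq> w" unfolding bs(1) by (rule le_mul_add[OF N])
    then have "n \<preceq> s" "clear s w" using w bs unfolding P_def clear_def less_succ by blast+
    then show "\<exists>w s. s \<prec> N \<and> n \<preceq> s \<and> clear s w" using bs(2) by blast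
  next
    assume "\<exists>w s. s \<prec> N \<and> n \<preceq> s \<and> clear s w"
    then obtain w s where *: "s \<prec> N" "n \<preceq> s" "clear s w" by blast
    have "P n (w \<otimes> N \<oplus> s) x" for x
      unfolding P_def
    proof (intro allI impI)
      fix s' b assume "s' \<prec> N" "w \<otimes> N \<oplus> s = b \<otimes> N \<oplus> s'"
      then have "s' = s" using division_unique *(1) by blast
      moreover have "w \<preceq> x" if "w \<otimes> N \<oplus> s \<preceq> x"
        using le_mul_add[OF N] that by (rule N.order_trans)
      ultimately show "n \<preceq> s' \<and> (w \<otimes> N \<oplus> s \<preceq> x \<longrightarrow>
          (\<forall>v. v \<prec> k \<longrightarrow> code_pair x v \<in> f \<longrightarrow> \<not> bit v s'))"
        using * unfolding clear_def by blast
    qed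
    then show "\<exists>w. \<forall>x. P n w x" by blast
  qed
  have "\<exists>w. \<forall>x. P N w x"
  proof (rule sigma02_induct[OF assms])
    show "delta0 (\<lambda>e. P (e 2) (e 1) (e 0))"
      unfolding P_def by (intro delta0_rules delta0_bit f)
    have "clear \<zero> \<zero>" unfolding clear_def using not_bit_zero by blast
    then show "\<exists>w. \<forall>x. P \<zero> w x" unfolding P_iff using N by blast
  next
    fix n assume "\<exists>w. \<forall>x. P n w x"
    then obtain w s where ws: "s \<prec> N" "n \<preceq> s" "clear s w" unfolding P_iff by blast
    obtain x where x: "w \<preceq> x" "\<And>y v. x \<prec> y \<Longrightarrow> code_pair x v \<in> f \<Longrightarrow> code_pair y v \<notin> f"
      using last by blast
    obtain v where v: "code_pair x v \<in> f" using ex1_implies_ex[OF fn[rule_format]] by blast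
    then have "v \<prec> k" using rng code_pair_inject by metis
    then have "\<not> bit v s" using ws(3) x(1) v unfolding clear_def by blast
    note ins = insert_bit[OF this, of k, folded N_def, OF ws(1) \<open>v \<prec> k\<close>]
    have "n \<prec> s \<oplus> pow2 v"
      using ws(2) pow2_pos[of v] N.le_less_trans[of n s] by simp
    then have "n \<oplus> \<one> \<preceq> s \<oplus> pow2 v" unfolding succ_le_iff .
    moreover have "clear (s \<oplus> pow2 v) (x \<oplus> \<one>)"
      unfolding clear_def succ_le_iff
    proof (intro allI impI)
      fix y i assume y: "x \<prec> y" "i \<prec> k" "code_pair y i \<in> f"
      then have "w \<preceq> y" using x(1) by (meson N.le_less_trans N.less_imp_le)
      then have "\<not> bit i s" using ws(3) y unfolding clear_def by blast
      moreover have "i \<noteq> v" using x(2) y v by blast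
      ultimately show "\<not> bit i (s \<oplus> pow2 v)" using ins(2) by blast
    qed
    ultimately show "\<exists>w. \<forall>x. P (n \<oplus> \<one>) w x" unfolding P_iff using ins(1) by blast
  qed
  then show False unfolding P_iff using N.not_le by blast
qed

section \<open>From eventually recurring colours to induction\<close>

text \<open>
  Closure under terms is built into the definition, so that equations between values of \<open>F\<close> at
  compound arguments are covered.
\<close>

definition delta0_graph :: "('a \<Rightarrow> 'a) \<Rightarrow> bool" where
  "delta0_graph F \<longleftrightarrow>
    (\<forall>T S. definable_trm T \<longrightarrow> definable_trm S \<longrightarrow> delta0 (\<lambda>e. F (T e) = S e))"

lemma delta0_graphD:
  "delta0_graph F \<Longrightarrow> definable_trm T \<Longrightarrow> definable_trm S \<Longrightarrow> delta0 (\<lambda>e. F (T e) = S e)"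
  unfolding delta0_graph_def by simp

lemma ECT_function:
  assumes ECT: "models M {ECT}" and F: "delta0_graph F" "\<And>x. F x \<prec> k"
  shows "\<exists>b. \<forall>x. b \<preceq> x \<longrightarrow> (\<exists>y. x \<prec> y \<and> F y = F x)"
proof -
  define f where "f = {n. \<exists>i. i \<prec> n \<oplus> \<one> \<and> (\<exists>j. j \<prec> n \<oplus> \<one> \<and> n = code_pair i j \<and> F i = j)}"
  have F_eq: "delta0 (\<lambda>e. F (e i) = e j)" for i j
    by (intro delta0_graphD[OF F(1)] definable_var)
  have "f \<in> Sets M"
    unfolding f_def by (rule delta0_comprehension) (rule F_eq | rule delta0_rules)+
  moreover have mem: "code_pair i j \<in> f \<longleftrightarrow> F i = j" for i j
  proof
    assume "F i = j"
    then show "code_pair i j \<in> f"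
      unfolding f_def mem_Collect_eq less_succ
      by (intro exI[of _ i] conjI exI[of _ j] code_pair_bounds refl)
  qed (auto simp only: f_def mem_Collect_eq code_pair_inject)
  moreover have "\<forall>n\<in>f. \<exists>i j. n = code_pair i j \<and> j \<prec> k"
    unfolding f_def using F(2) by auto
  moreover have "\<forall>i. \<exists>!j. code_pair i j \<in> f" unfolding mem by simp
  ultimately have "\<exists>b. \<forall>x. b \<preceq> x \<longrightarrow>
      (\<exists>y. x \<prec> y \<and> (\<exists>v. code_pair x v \<in> f \<and> code_pair y v \<in> f))"
    using ECT[unfolded models_ECT_iff, THEN spec[of _ k], THEN bspec[of _ _ f]] by simp
  then show ?thesis unfolding mem by simp
qed

text \<open>
  The hypothesis on \<open>F\<close> holds for monotone functions, both increasing and decreasing. From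
  the number given by ECT on, every value recurs, so it is also the next value.
\<close>

lemma ECT_eventually_constant:
  assumes "models M {ECT}" "delta0_graph F" "\<And>x. F x \<prec> k"
    and conv: "\<And>x y. x \<prec> y \<Longrightarrow> F y = F x \<Longrightarrow> F (x \<oplus> \<one>) = F x"
  shows "\<exists>b. \<forall>x. b \<preceq> x \<longrightarrow> F x = F b"
proof -
  obtain b where b: "\<And>x. b \<preceq> x \<Longrightarrow> \<exists>y. x \<prec> y \<and> F y = F x"
    using ECT_function[OF assms(1-3)] by blast
  have "F (b \<oplus> z) = F b" for z
  proof (rule delta0_induct[where P = "\<lambda>z. F (b \<oplus> z) = F b"])
    have "definable_trm (\<lambda>e. b \<oplus> e 0)" by (intro delta0_rules)
    then show "delta0 (\<lambda>e. F (b \<oplus> e 0) = F b)"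
      by (rule delta0_graphD[OF assms(2) _ definable_const])
    show "F (b \<oplus> (n \<oplus> \<one>)) = F b" if n: "F (b \<oplus> n) = F b" for n
    proof -
      obtain y where "b \<oplus> n \<prec> y" "F y = F (b \<oplus> n)"
        using b[of "b \<oplus> n"] by (auto simp: zero_le')
      then show ?thesis using conv n by (simp only: add_succ)
    qed
  qed simp
  then show ?thesis unfolding le_iff_add' by auto
qed

definition least_of :: "('a \<Rightarrow> bool) \<Rightarrow> 'a" where
  "least_of P = (SOME m. P m \<and> (\<forall>x. x \<prec> m \<longrightarrow> \<not> P x))"

lemma least_of_eq_iff:
  assumes "delta0 (\<lambda>e. P (e 0))" "P a"
  shows "least_of P = m \<longleftrightarrow> P m \<and> (\<forall>x. x \<prec> m \<longrightarrow> \<not> P x)"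
proof -
  have "\<exists>m. P m \<and> (\<forall>x. x \<prec> m \<longrightarrow> \<not> P x)" using assms by (rule delta0_least)
  then have "P (least_of P) \<and> (\<forall>x. x \<prec> least_of P \<longrightarrow> \<not> P x)"
    unfolding least_of_def by (rule someI_ex)
  then show ?thesis using N.less_linear[of "least_of P" m] by blast
qed

text \<open>
  The matrix \<open>\<theta>\<close> of a \<open>\<Sigma>\<^sup>0\<^sub>2\<close> formula enters only through its definability, in a form that
  allows terms to be substituted for its three arguments.
\<close>

context
  fixes \<theta> :: "'a \<Rightarrow> 'a \<Rightarrow> 'a \<Rightarrow> bool"
  assumes delta0_\<theta>: "\<And>T S R. definable_trm T \<Longrightarrow> definable_trm S \<Longrightarrow> definable_trm R \<Longrightarrow>
      delta0 (\<lambda>e. \<theta> (T e) (S e) (R e))"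
begin

text \<open>
  The candidate \<open>c\<close> has not been refuted up to stage \<open>t\<close>. Declaring \<open>t + 1\<close> alive makes the least such
  \<open>c\<close> exist at every stage without any search beyond \<open>t + 1\<close>.
\<close>

definition alive where "alive n t c \<longleftrightarrow> c = t \<oplus> \<one> \<or> (\<forall>x. x \<prec> t \<oplus> \<one> \<longrightarrow> \<theta> n c x)"

lemma delta0_alive:
  assumes "definable_trm T" "definable_trm S" "definable_trm R"
  shows "delta0 (\<lambda>e. alive (T e) (S e) (R e))"
  unfolding alive_def by (intro delta0_rules delta0_\<theta> assms assms[THEN definable_reindex])

definition guess where "guess n t = least_of (alive n t)"

lemma guess_eq_iff: "guess n t = c \<longleftrightarrow> alive n t c \<and> (\<forall>d. d \<prec> c \<longrightarrow> \<not> alive n t d)"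
  unfolding guess_def
  by (rule least_of_eq_iff[of _ "t \<oplus> \<one>"]) (intro delta0_alive delta0_rules, simp add: alive_def)

lemma alive_guess: "alive n t (guess n t)"
  and guess_le: "alive n t c \<Longrightarrow> guess n t \<preceq> c"
  using guess_eq_iff[of n t "guess n t"] N.not_less by auto

lemma guess_le_succ: "guess n t \<preceq> t \<oplus> \<one>"
  by (rule guess_le) (simp add: alive_def)

text \<open>
  A guess at the later stage \<open>t\<close> that is smaller than the one at \<open>s\<close> is at most \<open>s\<close>, so it is not the
  default value \<open>t + 1\<close>; being unrefuted at \<open>t\<close>, it was unrefuted at \<open>s\<close>.
\<close>

lemma guess_mono:
  assumes "s \<preceq> t"
  shows "guess n s \<preceq> guess n t"
proof (rule ccontr)
  assume "\<not> guess n s \<preceq> guess n t"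
  then have less: "guess n t \<prec> guess n s" by (simp add: N.not_le)
  then have "guess n t \<prec> s \<oplus> \<one>" using guess_le_succ by (rule N.less_le_trans)
  also have "\<dots> \<preceq> t \<oplus> \<one>" using assms by simp
  finally have "\<forall>x. x \<prec> t \<oplus> \<one> \<longrightarrow> \<theta> n (guess n t) x" using alive_guess[of n t] unfolding alive_def by auto
  then have "alive n s (guess n t)"
    unfolding alive_def using \<open>s \<oplus> \<one> \<preceq> t \<oplus> \<one>\<close> by (meson N.less_le_trans)
  then show False using guess_le less N.not_le by blast
qed

definition stable where
  "stable n t \<longleftrightarrow> (\<exists>c. c \<prec> t \<oplus> \<one> \<oplus> \<one> \<and> guess n t = c \<and> guess n (t \<oplus> \<one>) = c)"

lemma stable_iff: "stable n t \<longleftrightarrow> guess n (t \<oplus> \<one>) = guess n t"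
  unfolding stable_def less_succ[of _ "t \<oplus> \<one>"] using guess_le_succ by auto


lemma delta0_guess:
  assumes "definable_trm T" "definable_trm S" "definable_trm R"
  shows "delta0 (\<lambda>e. guess (T e) (S e) = R e)"
  unfolding guess_eq_iff
  by (intro delta0_rules delta0_alive assms assms[THEN definable_reindex])

lemma delta0_stable:
  assumes "definable_trm T" "definable_trm S"
  shows "delta0 (\<lambda>e. stable (T e) (S e))"
  unfolding stable_def
  by (rule delta0_guess delta0_rules assms assms[THEN definable_reindex])+

text \<open>
  The constant guess from stage \<open>B\<close> on is at most \<open>B + 1\<close>, so from stage \<open>B + 1\<close> on it is not the
  default value and is confirmed by every \<open>x\<close>.
\<close>

lemma witness_if_stable:
  assumes "\<And>t. B \<preceq> t \<Longrightarrow> stable n t"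
  shows "\<exists>b. \<forall>x. \<theta> n b x"
proof -
  have const: "guess n (B \<oplus> z) = guess n B" for z
  proof (rule delta0_induct[where P = "\<lambda>z. guess n (B \<oplus> z) = guess n B"])
    show "delta0 (\<lambda>e. guess n (B \<oplus> e 0) = guess n B)"
      by (intro delta0_guess) (intro delta0_rules)+
    show "guess n (B \<oplus> (m \<oplus> \<one>)) = guess n B" if "guess n (B \<oplus> m) = guess n B" for m
      using assms[of "B \<oplus> m"] that by (simp add: stable_iff zero_le' add_succ)
  qed simp
  have "\<theta> n (guess n B) x" for x
  proof -
    let ?t = "B \<oplus> x \<oplus> \<one>"
    have "alive n ?t (guess n B)" using alive_guess[of n ?t] const[of "x \<oplus> \<one>"] by (simp add: add_assoc')
    moreover have "guess n B \<preceq> ?t"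
      using guess_le_succ by (rule N.order_trans) (simp add: zero_le')
    then have "guess n B \<noteq> ?t \<oplus> \<one>"
      unfolding less_succ[symmetric] by (rule N.less_imp_neq)
    ultimately have "\<forall>y. y \<prec> ?t \<oplus> \<one> \<longrightarrow> \<theta> n (guess n B) y"
      unfolding alive_def by blast
    moreover have "x \<preceq> ?t"
      unfolding le_iff_add' by (rule exI[of _ "B \<oplus> \<one>"]) (simp add: algebra_simps)
    then have "x \<prec> ?t \<oplus> \<one>" unfolding less_succ .
    ultimately show ?thesis by blast
  qed
  then show ?thesis by blast
qed

text \<open>
  A witness stays alive forever and thus bounds the increasing sequence of guesses.
\<close>

lemma stable_if_witness:
  assumes "models M {ECT}" and b: "\<forall>x. \<theta> n b x"
  shows "\<exists>B. \<forall>t. B \<preceq> t \<longrightarrow> stable n t"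
proof -
  have bounded: "guess n t \<prec> b \<oplus> \<one>" for t
    unfolding less_succ using b by (intro guess_le) (simp add: alive_def)
  have graph: "delta0_graph (guess n)"
    unfolding delta0_graph_def by (intro allI impI delta0_guess definable_const)
  have conv: "guess n (x \<oplus> \<one>) = guess n x" if "x \<prec> y" "guess n y = guess n x" for x y
  proof (rule N.order_antisym)
    show "guess n (x \<oplus> \<one>) \<preceq> guess n x"
      using guess_mono[of "x \<oplus> \<one>" y n] that by (simp add: succ_le_iff)
    show "guess n x \<preceq> guess n (x \<oplus> \<one>)" by (rule guess_mono) (simp add: zero_le')
  qed
  have "\<exists>B. \<forall>t. B \<preceq> t \<longrightarrow> guess n t = guess n B"
    by (rule ECT_eventually_constant[OF assms(1) graph bounded]) (rule conv)
  then obtain B where B: "\<And>t. B \<preceq> t \<Longrightarrow> guess n t = guess n B" by blast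
  have "stable n t" if "B \<preceq> t" for t
  proof -
    have "B \<preceq> t \<oplus> \<one>" using that by (rule N.order_trans) (simp add: zero_le')
    then show ?thesis unfolding stable_iff using B[of t] B[of "t \<oplus> \<one>"] that by simp
  qed
  then show ?thesis by blast
qed

text \<open>
  The number \<open>q (a + 1) + n\<close> stands for stage \<open>q\<close> of the guesses for \<open>n\<close>. Giving each \<open>n\<close> its own
  numbers lets a single function record the changes of all guesses, even if several change
  at the same stage.
\<close>

lemma sigma02_induct_if_ECT:
  assumes ECT: "models M {ECT}"
    and zero: "\<exists>b. \<forall>x. \<theta> \<zero> b x"
    and succ: "\<And>n. \<exists>b. \<forall>x. \<theta> n b x \<Longrightarrow> \<exists>b. \<forall>x. \<theta> (n \<oplus> \<one>) b x"
  shows "\<exists>b. \<forall>x. \<theta> a b x"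
proof (rule ccontr)
  assume no_a: "\<nexists>b. \<forall>x. \<theta> a b x"
  define N where "N = a \<oplus> \<one>"
  have N: "\<zero> \<prec> N" unfolding N_def less_succ by (rule zero_le')
  define event where "event w v \<longleftrightarrow> (\<exists>q. q \<prec> w \<oplus> \<one> \<and> (\<exists>n. n \<prec> N \<and> w = q \<otimes> N \<oplus> n \<and>
    (stable n q \<and> v = N \<or> \<not> stable n q \<and> v = n)))" for w v
  define F where "F w = (THE v. event w v)" for w
  have event_iff: "event (q \<otimes> N \<oplus> n) v \<longleftrightarrow> v = (if stable n q then N else n)" if "n \<prec> N" for q n v
    unfolding event_def less_succ
    using division_unique[of q N n] that le_mul_add[OF N, of q n] by auto
  have F: "F (q \<otimes> N \<oplus> n) = (if stable n q then N else n)" if "n \<prec> N" for q n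
    unfolding F_def event_iff[OF that] by simp
  have F_eq_iff: "F w = v \<longleftrightarrow> event w v" for w v
    using division[OF N, of w] event_iff F by metis
  have F_graph: "delta0_graph F"
    unfolding delta0_graph_def F_eq_iff event_def
    by (intro allI impI)
      (rule delta0_stable delta0_rules | (rule definable_reindex, assumption))+
  have "F w \<prec> N \<oplus> \<one>" for w
    using division[OF N, of w] F unfolding less_succ by (metis N.less_imp_le N.order_refl)
  then obtain B where B: "\<And>x. B \<preceq> x \<Longrightarrow> \<exists>y. x \<prec> y \<and> F y = F x"
    using ECT_function[OF ECT F_graph] by blast
  define occurs where "occurs n \<longleftrightarrow> (\<exists>x. B \<preceq> x \<and> F x = n)" for n
  have witness: "\<exists>b. \<forall>x. \<theta> n b x" if "n \<prec> N" "\<not> occurs n" for n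
  proof (rule witness_if_stable)
    fix t assume "B \<preceq> t"
    then have "B \<preceq> t \<otimes> N \<oplus> n" using le_mul_add[OF N] by (rule N.order_trans)
    then have "F (t \<otimes> N \<oplus> n) \<noteq> n" using that(2) unfolding occurs_def by blast
    then show "stable n t" using F[OF that(1)] by metis
  qed
  have no_witness: "\<nexists>b. \<forall>x. \<theta> n b x" if n: "n \<prec> N" and occ: "occurs n" for n
  proof
    assume "\<exists>b. \<forall>x. \<theta> n b x"
    then obtain C where C: "\<And>t. C \<preceq> t \<Longrightarrow> stable n t" using stable_if_witness[OF ECT] by blast
    \<comment> \<open>The occurrences of \<open>n\<close> from \<open>B\<close> on would be bounded, so there would be a last one.\<close>
    let ?P = "\<lambda>x. B \<preceq> x \<and> F x = n"
    obtain x where "?P x" using occ unfolding occurs_def by blast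
    moreover have "x \<prec> C \<otimes> N" if "?P x" for x
    proof -
      obtain q m where qm: "x = q \<otimes> N \<oplus> m" "m \<prec> N" using division[OF N] by metis
      then have "\<not> stable n q" using that F[OF qm(2)] n by (auto split: if_splits)
      then have "q \<prec> C" using C N.not_le by blast
      then show ?thesis using division_less[of q C m N \<zero>] qm by simp
    qed
    moreover have "delta0 (\<lambda>e. ?P (e 0))"
      by (rule delta0_graphD[OF F_graph] delta0_rules)+
    ultimately obtain m where "?P m" "\<And>x. m \<prec> x \<Longrightarrow> \<not> ?P x"
      using delta0_greatest[of ?P x "C \<otimes> N"] by blast
    then show False using B[of m] by (metis N.less_imp_le N.order_trans)
  qed
  \<comment> \<open>The least number below \<open>N\<close> that occurs from \<open>B\<close> on is found as the limit of its approximations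
    \<open>h t\<close>; the value \<open>a\<close>, at which the formula fails, serves as default.\<close>
  define found where "found t v \<longleftrightarrow> v = a \<or> (\<exists>x. x \<prec> t \<oplus> \<one> \<and> B \<preceq> x \<and> event x v)" for t v
  have delta0_found: "delta0 (\<lambda>e. found (T e) (S e))"
    if "definable_trm T" "definable_trm S" for T S
    unfolding found_def event_def
    by (rule delta0_stable delta0_rules that that[THEN definable_reindex])+
  define h where "h t = least_of (found t)" for t
  have h_eq_iff: "h t = v \<longleftrightarrow> found t v \<and> (\<forall>u. u \<prec> v \<longrightarrow> \<not> found t u)" for t v
    unfolding h_def
    by (rule least_of_eq_iff[of _ a]) (intro delta0_found delta0_rules, simp add: found_def)
  have found_h: "found t (h t)" and h_le: "found t v \<Longrightarrow> h t \<preceq> v" for t v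
    using h_eq_iff[of t "h t"] N.not_less by auto
  have h_antimono: "h t \<preceq> h s" if "s \<preceq> t" for s t
  proof -
    have "found t (h s)"
      using found_h[of s] that N.order_trans unfolding found_def less_succ by blast
    then show ?thesis by (rule h_le)
  qed
  have h_graph: "delta0_graph h"
    unfolding delta0_graph_def h_eq_iff
    by (intro allI impI)
      (rule delta0_found delta0_rules | assumption | (rule definable_reindex, assumption))+
  have h_bounded: "h t \<prec> N" for t
    unfolding N_def less_succ by (rule h_le) (simp add: found_def)
  have h_conv: "h (x \<oplus> \<one>) = h x" if "x \<prec> y" "h y = h x" for x y
  proof (rule N.order_antisym)
    show "h x \<preceq> h (x \<oplus> \<one>)"
      using h_antimono[of "x \<oplus> \<one>" y] that by (simp add: succ_le_iff)
    show "h (x \<oplus> \<one>) \<preceq> h x" by (rule h_antimono) (simp add: zero_le')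
  qed
  have "\<exists>b. \<forall>x. b \<preceq> x \<longrightarrow> h x = h b"
    by (rule ECT_eventually_constant[OF ECT h_graph h_bounded]) (rule h_conv)
  then obtain b where b: "\<And>x. b \<preceq> x \<Longrightarrow> h x = h b" by blast
  define c where "c = h b"
  have "c \<prec> N" unfolding c_def by (rule h_bounded)
  have "\<nexists>b. \<forall>x. \<theta> c b x"
    using found_h[of b, folded c_def] no_a no_witness[OF \<open>c \<prec> N\<close>]
    unfolding found_def occurs_def F_eq_iff by blast
  then have "c \<noteq> \<zero>" using zero by auto
  then obtain d where d: "c = d \<oplus> \<one>" using ne_zero_succ by blast
  then have "d \<prec> c" by (simp add: less_succ)
  \<comment> \<open>Otherwise the approximations would eventually be at most \<open>d\<close>.\<close>
  have "\<not> occurs d"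
  proof
    assume "occurs d"
    then obtain x where x: "B \<preceq> x" "event x d" unfolding occurs_def F_eq_iff by blast
    then have "found (b \<oplus> x) d"
      unfolding found_def less_succ using le_iff_add' add_commute' by metis
    then have "h (b \<oplus> x) \<preceq> d" by (rule h_le)
    moreover have "h (b \<oplus> x) = c" unfolding c_def using b le_iff_add' by blast
    ultimately show False using \<open>d \<prec> c\<close> N.not_le by blast
  qed
  then have "\<exists>b. \<forall>x. \<theta> d b x" using witness \<open>d \<prec> c\<close> \<open>c \<prec> N\<close> N.less_trans by blast
  then have "\<exists>b. \<forall>x. \<theta> c b x" unfolding d by (rule succ)
  with \<open>\<nexists>b. \<forall>x. \<theta> c b x\<close> show False by contradiction
qed

end

lemma ISigma02_if_ECT:
  assumes "models M {ECT}"
  shows "models M ISigma02"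
  unfolding models_def
proof (intro ballI allI impI)
  fix p and e :: "nat \<Rightarrow> 'a" and E :: "nat \<Rightarrow> 'a set"
  assume "p \<in> ISigma02" and E: "range E \<subseteq> Sets M"
  then obtain q where q: "q \<in> bounded_fms" "p = induction_axiom (Ex (All q))"
    by (auto simp: ISigma02_def induction_scheme_def numeral_eq_Suc)
  define \<theta> where "\<theta> n b x \<longleftrightarrow> sat M (case_nat x (case_nat b (case_nat n e))) E q" for n b x
  have "delta0 (\<lambda>e. \<theta> (T e) (S e) (R e))"
    if "definable_trm T" "definable_trm S" "definable_trm R" for T S R
    unfolding \<theta>_def by (intro delta0_sat q E that)
  from sigma02_induct_if_ECT[of \<theta>, OF this assms]
  have "(\<exists>b. \<forall>x. \<theta> \<zero> b x) \<Longrightarrow> (\<And>n. \<exists>b. \<forall>x. \<theta> n b x \<Longrightarrow> \<exists>b. \<forall>x. \<theta> (n \<oplus> \<one>) b x) \<Longrightarrow>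
      \<exists>b. \<forall>x. \<theta> a b x" for a .
  then show "sat M e E p"
    unfolding q(2) sat_induction_axiom sat.simps \<theta>_def by blast
qed

end

theorem theorem7:
  fixes M :: "'a l2_structure"
  assumes "Sets M \<noteq> {}"
    and "models M RCA0_star"
  shows "models M ISigma02 \<longleftrightarrow> models M {ECT}"
proof -
  interpret rca0_star M using assms by unfold_locales
  show ?thesis using ECT_if_ISigma02 ISigma02_if_ECT by blast
qed

end
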